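(* Let $(K,d)$ be a metric space and let $W$ be a closed subspace of $\mathrm{Lip}(K)$ with $\mathrm{lip}(K)\subset W$ satisfying the following condition: for any $h\in B_W$, any $\varepsilon'>0$ and any $\delta'>0$ there exists some $g\in\mathrm{lip}(K)$ with $$\|h-g\|_\infty\le\varepsilon'\delta'$$ and $$0<d(x,y)\le\delta'\ \Longrightarrow\ L_{xy}(h-g)\le 1+\varepsilon'\qquad\text{for all }x,y\in K.$$ Then $\mathrm{lip}(K)$ is an $M$-ideal in $W$. The analogous statement holds for $\mathrm{Lip}_0(K)$: if $W$ is a closed subspace of $\mathrm{Lip}_0(K)$ (with norm $L(\cdot)$) with $\mathrm{lip}_0(K)\subset W$, and for any $h\in B_W$, $\varepsilon'>0$, $\delta'>0$ there exists $g\in\mathrm{lip}_0(K)$ with $\|h-g\|_\infty\le\varepsilon'\delta'$ and $L_{xy}(h-g)\le1+\varepsilon'$ for all $x,y\in K$ with $0<d(x,y)\le\delta'$, then $\mathrm{lip}_0(K)$ is an $M$-ideal in $W$.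
   Context: Scalars are real or complex. For a scalar-valued function $f$ on a metric space $(K,d)$ and $x\ne y$ in $K$ put $L_{xy}(f)=\frac{|f(x)-f(y)|}{d(x,y)}$ and $L(f)=\sup_{x\ne y}L_{xy}(f)$. $\mathrm{Lip}(K)$ is the Banach space of all bounded functions $f$ on $K$ with $L(f)<\infty$, with norm $\|f\|_L=\max(\|f\|_\infty,L(f))$, where $\|\cdot\|_\infty$ is the sup norm. $\mathrm{lip}(K)$ is the closed subspace of those $f\in\mathrm{Lip}(K)$ satisfying the uniform lip-condition $\lim_{d(x,y)\to0,\,x\ne y}\frac{|f(x)-f(y)|}{d(x,y)}=0$. For a fixed base point $x_0\in K$, $\mathrm{Lip}_0(K)$ is the Banach space of all (possibly unbounded) functions $f$ on $K$ with $L(f)<\infty$ and $f(x_0)=0$, with norm $L(\cdot)$, and $\mathrm{lip}_0(K)$ is its closed subspace of functions satisfying the uniform lip-condition. $B_W$ denotes the closed unit ball of $W$. Let $X$ be a Banach space. A linear projection $P$ on a Banach space $Y$ is an $L$-projection if $\|y\|=\|P(y)\|+\|y-P(y)\|$ for all $y\in Y$; an $L$-summand is the range of an $L$-projection. A closed subspace $U\subset X$ is an $M$-ideal in $X$ if its annihilator $U^\perp$ is an $L$-summand in the dual $X'$. *)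

theory Defs
  imports "HOL-Analysis.Analysis" "HOL-Library.Function_Algebras"
begin

text \<open>
  Normed spaces are given by a scalar multiplication \<open>s\<close>, a carrier set \<open>X\<close> inside an additive
  group type, and a norm \<open>n\<close> on \<open>X\<close>. This allows complex scalars and lets subspaces and
  duals of such spaces be spaces of the same kind. \<^locale>\<open>Metric_space\<close> also asks the induced
  distance to be nonnegative and symmetric off the carrier; both norms on Lipschitz functions
  below satisfy this.
\<close>

definition norm_dist :: "('v::ab_group_add \<Rightarrow> real) \<Rightarrow> 'v \<Rightarrow> 'v \<Rightarrow> real" where
  "norm_dist n x y = n (x - y)"

definition banach_on ::
    "('k::real_normed_field \<Rightarrow> 'v::ab_group_add \<Rightarrow> 'v) \<Rightarrow> 'v set \<Rightarrow> ('v \<Rightarrow> real) \<Rightarrow> bool" where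
  "banach_on s X n \<longleftrightarrow>
     vector_space s \<and> module.subspace s X \<and>
     (\<forall>x\<in>X. 0 \<le> n x \<and> (n x = 0 \<longleftrightarrow> x = 0)) \<and>
     (\<forall>x\<in>X. \<forall>y\<in>X. n (x + y) \<le> n x + n y) \<and>
     (\<forall>c. \<forall>x\<in>X. n (s c x) = norm c * n x) \<and>
     Metric_space X (norm_dist n) \<and> Metric_space.mcomplete X (norm_dist n)"

definition closed_subspace ::
    "('k::real_normed_field \<Rightarrow> 'v::ab_group_add \<Rightarrow> 'v) \<Rightarrow> 'v set \<Rightarrow> ('v \<Rightarrow> real) \<Rightarrow> 'v set \<Rightarrow> bool" where
  "closed_subspace s X n U \<longleftrightarrow>
     U \<subseteq> X \<and> module.subspace s U \<and> closedin (Metric_space.mtopology X (norm_dist n)) U"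

definition linear_map_on ::
    "('k::real_normed_field \<Rightarrow> 'v::ab_group_add \<Rightarrow> 'v) \<Rightarrow> ('k \<Rightarrow> 'w::ab_group_add \<Rightarrow> 'w)
      \<Rightarrow> 'v set \<Rightarrow> ('v \<Rightarrow> 'w) \<Rightarrow> bool" where
  "linear_map_on s t X f \<longleftrightarrow>
     (\<forall>x\<in>X. \<forall>y\<in>X. f (x + y) = f x + f y) \<and> (\<forall>c. \<forall>x\<in>X. f (s c x) = t c (f x))"

definition fun_scale :: "'k::real_normed_field \<Rightarrow> ('b \<Rightarrow> 'k) \<Rightarrow> 'b \<Rightarrow> 'k" where
  "fun_scale c f = (\<lambda>x. c * f x)"

text \<open>
  Functionals on \<open>X\<close> are extended by \<open>0\<close> outside \<open>X\<close>, so that each one is represented by exactly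
  one function and the vector space operations are pointwise.
\<close>

definition dual_space ::
    "('k::real_normed_field \<Rightarrow> 'v::ab_group_add \<Rightarrow> 'v) \<Rightarrow> 'v set \<Rightarrow> ('v \<Rightarrow> real) \<Rightarrow> ('v \<Rightarrow> 'k) set" where
  "dual_space s X n =
     {\<phi>. linear_map_on s (*) X \<phi> \<and> (\<exists>B. \<forall>x\<in>X. norm (\<phi> x) \<le> B * n x) \<and> (\<forall>x. x \<notin> X \<longrightarrow> \<phi> x = 0)}"

definition dual_norm ::
    "'v set \<Rightarrow> ('v \<Rightarrow> real) \<Rightarrow> ('v \<Rightarrow> 'k::real_normed_field) \<Rightarrow> real" where
  "dual_norm X n \<phi> = (SUP x\<in>{x\<in>X. n x \<le> 1}. norm (\<phi> x))"

definition annihilator ::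
    "('k::real_normed_field \<Rightarrow> 'v::ab_group_add \<Rightarrow> 'v) \<Rightarrow> 'v set \<Rightarrow> ('v \<Rightarrow> real) \<Rightarrow> 'v set
      \<Rightarrow> ('v \<Rightarrow> 'k) set" where
  "annihilator s X n U = {\<phi> \<in> dual_space s X n. \<forall>u\<in>U. \<phi> u = 0}"

definition L_projection ::
    "('k::real_normed_field \<Rightarrow> 'v::ab_group_add \<Rightarrow> 'v) \<Rightarrow> 'v set \<Rightarrow> ('v \<Rightarrow> real) \<Rightarrow> ('v \<Rightarrow> 'v) \<Rightarrow> bool" where
  "L_projection s Y n P \<longleftrightarrow>
     P ` Y \<subseteq> Y \<and> linear_map_on s s Y P \<and> (\<forall>y\<in>Y. P (P y) = P y) \<and>
     (\<forall>y\<in>Y. n y = n (P y) + n (y - P y))"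

definition L_summand ::
    "('k::real_normed_field \<Rightarrow> 'v::ab_group_add \<Rightarrow> 'v) \<Rightarrow> 'v set \<Rightarrow> ('v \<Rightarrow> real) \<Rightarrow> 'v set \<Rightarrow> bool" where
  "L_summand s Y n Z \<longleftrightarrow> (\<exists>P. L_projection s Y n P \<and> Z = P ` Y)"

definition M_ideal ::
    "('k::real_normed_field \<Rightarrow> 'v::ab_group_add \<Rightarrow> 'v) \<Rightarrow> 'v set \<Rightarrow> ('v \<Rightarrow> real) \<Rightarrow> 'v set \<Rightarrow> bool" where
  "M_ideal s X n U \<longleftrightarrow>
     banach_on s X n \<and> closed_subspace s X n U \<and>
     L_summand fun_scale (dual_space s X n) (dual_norm X n) (annihilator s X n U)"

text \<open>
  The suprema are taken in \<^typ>\<open>ennreal\<close>: they may be infinite, and the supremum over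
  the empty set (a one-point metric space) is \<open>0\<close>.
\<close>

definition Lquot :: "'a::metric_space \<Rightarrow> 'a \<Rightarrow> ('a \<Rightarrow> 'k::real_normed_field) \<Rightarrow> real" where
  "Lquot x y f = norm (f x - f y) / dist x y"

definition Lconst :: "('a::metric_space \<Rightarrow> 'k::real_normed_field) \<Rightarrow> ennreal" where
  "Lconst f = (SUP (x, y)\<in>{(x, y). x \<noteq> y}. ennreal (Lquot x y f))"

definition sup_norm :: "('a \<Rightarrow> 'k::real_normed_field) \<Rightarrow> ennreal" where
  "sup_norm f = (SUP x. ennreal (norm (f x)))"

definition lip_condition :: "('a::metric_space \<Rightarrow> 'k::real_normed_field) \<Rightarrow> bool" where
  "lip_condition f \<longleftrightarrow>
     ((\<lambda>(x, y). Lquot x y f) \<longlongrightarrow> 0) (filtercomap (\<lambda>(x, y). dist x y) (at_right 0))"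

definition Lip_space :: "('a::metric_space \<Rightarrow> 'k::real_normed_field) set" where
  "Lip_space = {f. bounded (range f) \<and> Lconst f < \<infinity>}"

definition Lip_norm :: "('a::metric_space \<Rightarrow> 'k::real_normed_field) \<Rightarrow> real" where
  "Lip_norm f = enn2real (max (sup_norm f) (Lconst f))"

definition little_lip :: "('a::metric_space \<Rightarrow> 'k::real_normed_field) set" where
  "little_lip = {f \<in> Lip_space. lip_condition f}"

definition Lip0_space :: "'a::metric_space \<Rightarrow> ('a \<Rightarrow> 'k::real_normed_field) set" where
  "Lip0_space x0 = {f. Lconst f < \<infinity> \<and> f x0 = 0}"

definition Lip0_norm :: "('a::metric_space \<Rightarrow> 'k::real_normed_field) \<Rightarrow> real" where
  "Lip0_norm f = enn2real (Lconst f)"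

definition little_lip0 :: "'a::metric_space \<Rightarrow> ('a \<Rightarrow> 'k::real_normed_field) set" where
  "little_lip0 x0 = {f \<in> Lip0_space x0. lip_condition f}"

definition ball_approximable ::
    "('a::metric_space \<Rightarrow> 'k::real_normed_field) set \<Rightarrow> (('a \<Rightarrow> 'k) \<Rightarrow> real) \<Rightarrow> ('a \<Rightarrow> 'k) set \<Rightarrow> bool" where
  "ball_approximable W n V \<longleftrightarrow>
     (\<forall>h\<in>W. n h \<le> 1 \<longrightarrow> (\<forall>\<epsilon>>0. \<forall>\<delta>>0. \<exists>g\<in>V.
        sup_norm (h - g) \<le> ennreal (\<epsilon> * \<delta>) \<and>
        (\<forall>x y. 0 < dist x y \<and> dist x y \<le> \<delta> \<longrightarrow> Lquot x y (h - g) \<le> 1 + \<epsilon>)))"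

end

theory Submission imports Defs begin

text \<open>
  The \<open>L\<close>-projection onto the annihilator is written down explicitly as a limit.

  Write \<open>U\<close> for the little Lipschitz functions in \<open>W\<close>. The approximation hypothesis, taken at
  \<open>\<delta>' = 1\<close>, provides for every \<open>h\<close> in the unit ball of \<open>W\<close> functions \<open>g\<^sub>m \<in> U\<close> with
  \<open>\<parallel>h - g\<^sub>m\<parallel>\<^sub>\<infinity> \<rightarrow> 0\<close> and \<open>lim sup \<parallel>h - g\<^sub>m\<parallel> \<le> 1\<close>. The other ingredient is a gliding hump
  (lemma \<open>little_glide\<close>): if \<open>f \<in> U\<close> and \<open>v\<close> both have norm at most \<open>C\<close> and \<open>v\<close> is uniformly small
  enough, then \<open>\<parallel>f + v\<parallel> \<le> C + \<epsilon>\<close>. On short distances the difference quotients of \<open>f\<close> are at most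
  \<open>\<epsilon>\<close>, and on long distances those of \<open>v\<close> are. Thus a little Lipschitz function and a uniformly
  small one behave almost like disjoint elements of a space \<open>c\<^sub>0\<close>.

  For a functional \<open>\<phi>\<close> on \<open>W\<close> put \<open>P \<phi> h = lim \<phi> (h - g\<^sub>m)\<close>. Bounded sequences in \<open>U\<close> that tend
  to \<open>0\<close> uniformly are mapped to null sequences by \<open>\<phi>\<close>, since gliding sums of many of them stay
  bounded (\<open>dual_q_null\<close>). Hence the limit exists, does not depend on the choice of \<open>g\<^sub>m\<close>, and is
  linear in \<open>h\<close> and \<open>\<phi>\<close>. It vanishes for \<open>h \<in> U\<close>, where \<open>g\<^sub>m = h\<close> is allowed, and equals \<open>\<phi> h\<close>
  when \<open>\<phi>\<close> annihilates \<open>U\<close>; so \<open>P\<close> is a projection onto the annihilator.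

  For \<open>\<parallel>P \<phi>\<parallel> + \<parallel>\<phi> - P \<phi>\<parallel> \<le> \<parallel>\<phi>\<parallel>\<close> take \<open>h\<close> and \<open>k\<close> in the unit ball of \<open>W\<close> that almost norm
  \<open>P \<phi>\<close> and \<open>\<phi> - P \<phi>\<close>. The approximants \<open>g\<^sub>m\<close> of \<open>k\<close> satisfy \<open>\<phi> g\<^sub>m \<rightarrow> (\<phi> - P \<phi>) k\<close>, but their norms
  are only bounded by about \<open>2\<close>. The average \<open>f\<close> of many of them, chosen one after the other with a
  gliding hump, has norm at most \<open>1 + \<epsilon>\<close> (\<open>averaged_approximant\<close>). With approximants \<open>g\<^sub>m\<close> of \<open>h\<close>
  the functions \<open>f + (h - g\<^sub>m)\<close> eventually have norm at most \<open>1 + 2 \<epsilon>\<close>, and \<open>\<phi>\<close> takes on them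
  values near \<open>(\<phi> - P \<phi>) k + P \<phi> h\<close>.

  Both kinds of Lipschitz space and both scalar fields are treated at once: the argument is carried
  out for a norm and a second gauge with these two properties in the locale \<open>glide_approximation\<close>.
\<close>

section \<open>An explicit L-projection onto an annihilator\<close>

lemma unimodular_rotation:
  fixes z :: "'k::real_normed_field"
  obtains \<theta> :: 'k where "norm \<theta> = 1" "\<theta> * z = of_real (norm z)"
proof (cases "z = 0")
  case True
  then show thesis using that[of 1] by simp
next
  case False
  then show thesis using that[of "of_real (norm z) / z"] by (simp add: norm_divide)
qed

text \<open>
  The second gauge \<open>q\<close> has values in \<^typ>\<open>ennreal\<close> because the uniform norm, to which it will be
  instantiated, may be infinite on Lipschitz functions vanishing at a base point. The assumption
  \<open>glide\<close> is the gliding hump, and \<open>approx\<close> is the approximation of the unit ball of \<open>W\<close> by \<open>U\<close>.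
  Completeness of the scalar field serves to define functionals by limits.
\<close>

locale glide_approximation = vector_space s
  for s :: "'k::{real_normed_field,banach} \<Rightarrow> 'v::ab_group_add \<Rightarrow> 'v" +
  fixes W U :: "'v set" and n :: "'v \<Rightarrow> real" and q :: "'v \<Rightarrow> ennreal"
  assumes W: "subspace W" and U: "subspace U" and U_W: "U \<subseteq> W"
    and n_ge0: "x \<in> W \<Longrightarrow> 0 \<le> n x"
    and n_eq0: "x \<in> W \<Longrightarrow> n x = 0 \<Longrightarrow> x = 0"
    and n_add: "x \<in> W \<Longrightarrow> y \<in> W \<Longrightarrow> n (x + y) \<le> n x + n y"
    and n_scale: "x \<in> W \<Longrightarrow> n (s c x) = norm c * n x"
    and q_add: "x \<in> W \<Longrightarrow> y \<in> W \<Longrightarrow> q (x + y) \<le> q x + q y"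
    and q_scale: "x \<in> W \<Longrightarrow> q (s c x) = ennreal (norm c) * q x"
    and glide: "f \<in> U \<Longrightarrow> n f \<le> A \<Longrightarrow> 0 < \<epsilon> \<Longrightarrow>
      \<exists>\<tau>>0. \<forall>v\<in>W. n v \<le> A \<longrightarrow> q v \<le> ennreal \<tau> \<longrightarrow> n (f + v) \<le> A + \<epsilon>"
    and approx: "h \<in> W \<Longrightarrow> n h \<le> 1 \<Longrightarrow> 0 < \<epsilon> \<Longrightarrow>
      \<exists>g\<in>U. q (h - g) \<le> ennreal \<epsilon> \<and> n (h - g) \<le> 1 + \<epsilon>"
begin

abbreviation D where "D \<equiv> dual_space s W n"

lemma UW [simp]: "u \<in> U \<Longrightarrow> u \<in> W"
  using U_W by blast

lemmas W_rules [simp] =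
  subspace_0[OF W] subspace_add[OF W] subspace_diff[OF W] subspace_scale[OF W] subspace_neg[OF W]
lemmas U_rules [simp] =
  subspace_0[OF U] subspace_add[OF U] subspace_diff[OF U] subspace_scale[OF U] subspace_neg[OF U]

lemma n_zero [simp]: "n 0 = 0"
  using n_scale[of 0 0] by simp

lemma q_zero [simp]: "q 0 = 0"
  using q_scale[of 0 0] by simp

lemma n_minus: "x \<in> W \<Longrightarrow> n (- x) = n x"
  using n_scale[of x "-1"] by simp

lemma q_minus: "x \<in> W \<Longrightarrow> q (- x) = q x"
  using q_scale[of x "-1"] by simp

lemma dual_add: "\<phi> \<in> D \<Longrightarrow> x \<in> W \<Longrightarrow> y \<in> W \<Longrightarrow> \<phi> (x + y) = \<phi> x + \<phi> y"
  and dual_scale: "\<phi> \<in> D \<Longrightarrow> x \<in> W \<Longrightarrow> \<phi> (s c x) = c * \<phi> x"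
  and dual_outside: "\<phi> \<in> D \<Longrightarrow> x \<notin> W \<Longrightarrow> \<phi> x = 0"
  by (auto simp: dual_space_def linear_map_on_def)

lemma dual_diff: "\<phi> \<in> D \<Longrightarrow> x \<in> W \<Longrightarrow> y \<in> W \<Longrightarrow> \<phi> (x - y) = \<phi> x - \<phi> y"
  using dual_add[of \<phi> "x - y" y] by simp

lemma dual_zero: "\<phi> \<in> D \<Longrightarrow> \<phi> 0 = 0"
  using dual_diff[of \<phi> 0 0] by simp

lemma dual_bound:
  assumes "\<phi> \<in> D"
  obtains B where "0 \<le> B" "\<And>x. x \<in> W \<Longrightarrow> norm (\<phi> x) \<le> B * n x"
proof -
  obtain B where B: "\<And>x. x \<in> W \<Longrightarrow> norm (\<phi> x) \<le> B * n x"
    using assms by (auto simp: dual_space_def)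
  have "norm (\<phi> x) \<le> max B 0 * n x" if "x \<in> W" for x
    using order_trans[OF B[OF that] mult_right_mono[OF max.cobounded1 n_ge0[OF that]]] .
  then show thesis using that[of "max B 0"] by simp
qed

lemma dual_norm_le:
  assumes "\<And>x. x \<in> W \<Longrightarrow> n x \<le> 1 \<Longrightarrow> norm (\<phi> x) \<le> C"
  shows "dual_norm W n \<phi> \<le> C"
  unfolding dual_norm_def
  by (rule cSUP_least) (use assms in \<open>auto intro: exI[of _ 0]\<close>)

lemma norm_le_dual_norm_unit:
  assumes "\<phi> \<in> D" "x \<in> W" "n x \<le> 1"
  shows "norm (\<phi> x) \<le> dual_norm W n \<phi>"
proof -
  obtain B where B: "0 \<le> B" "\<And>x. x \<in> W \<Longrightarrow> norm (\<phi> x) \<le> B * n x"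
    using dual_bound[OF assms(1)] by blast
  have "norm (\<phi> y) \<le> B" if "y \<in> W" "n y \<le> 1" for y
    using B(2)[OF that(1)] mult_left_mono[OF that(2) B(1)] by simp
  then show ?thesis
    unfolding dual_norm_def using assms by (intro cSUP_upper bdd_aboveI2[where M = B]) auto
qed

lemma norm_le_dual_norm:
  assumes "\<phi> \<in> D" "x \<in> W"
  shows "norm (\<phi> x) \<le> dual_norm W n \<phi> * n x"
proof (cases "n x = 0")
  case True
  then show ?thesis using n_eq0[OF assms(2)] dual_zero[OF assms(1)] by simp
next
  case False
  then have pos: "0 < n x" using n_ge0[OF assms(2)] by simp
  let ?y = "s (of_real (1 / n x)) x"
  have "norm (\<phi> ?y) \<le> dual_norm W n \<phi>"
    using assms pos by (intro norm_le_dual_norm_unit) (auto simp: n_scale norm_divide)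
  moreover have "norm (\<phi> ?y) = norm (\<phi> x) / n x"
    using assms pos by (simp add: dual_scale norm_mult norm_divide)
  ultimately show ?thesis using pos by (simp add: divide_le_eq)
qed

lemma dual_norm_ge0: "\<phi> \<in> D \<Longrightarrow> 0 \<le> dual_norm W n \<phi>"
  using norm_le_dual_norm_unit[of \<phi> 0] dual_zero[of \<phi>] by simp

lemma dualI:
  assumes "\<And>x y. x \<in> W \<Longrightarrow> y \<in> W \<Longrightarrow> \<phi> (x + y) = \<phi> x + \<phi> y"
    and "\<And>c x. x \<in> W \<Longrightarrow> \<phi> (s c x) = c * \<phi> x"
    and "\<And>x. x \<in> W \<Longrightarrow> norm (\<phi> x) \<le> B * n x" and "\<And>x. x \<notin> W \<Longrightarrow> \<phi> x = 0"
  shows "\<phi> \<in> D"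
  using assms by (auto simp: dual_space_def linear_map_on_def intro!: exI[of _ B])

lemma dual_space_diff:
  assumes "\<phi> \<in> D" "\<psi> \<in> D"
  shows "\<phi> - \<psi> \<in> D"
proof (rule dualI)
  fix x assume x: "x \<in> W"
  have "norm ((\<phi> - \<psi>) x) \<le> norm (\<phi> x) + norm (\<psi> x)" by (simp add: norm_triangle_ineq4)
  also have "\<dots> \<le> dual_norm W n \<phi> * n x + dual_norm W n \<psi> * n x"
    by (intro add_mono norm_le_dual_norm assms x)
  finally show "norm ((\<phi> - \<psi>) x) \<le> (dual_norm W n \<phi> + dual_norm W n \<psi>) * n x"
    by (simp add: algebra_simps)
qed (auto simp: dual_add[OF assms(1)] dual_add[OF assms(2)] dual_scale[OF assms(1)]
    dual_scale[OF assms(2)] dual_outside[OF assms(1)] dual_outside[OF assms(2)] algebra_simps)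

definition q_null :: "(nat \<Rightarrow> 'v) \<Rightarrow> bool" where
  "q_null v \<longleftrightarrow> range v \<subseteq> W \<and> (\<exists>C. \<forall>m. n (v m) \<le> C) \<and> (\<lambda>m. q (v m)) \<longlonglongrightarrow> 0"

lemma q_null_in: "q_null v \<Longrightarrow> v m \<in> W"
  by (auto simp: q_null_def)

lemma q_null_zero: "q_null (\<lambda>m. 0)"
  by (auto simp: q_null_def)

lemma q_null_add:
  assumes "q_null u" "q_null v"
  shows "q_null (\<lambda>m. u m + v m)"
proof -
  note [simp] = q_null_in[OF assms(1)] q_null_in[OF assms(2)]
  obtain C C' where C: "\<And>m. n (u m) \<le> C" "\<And>m. n (v m) \<le> C'"
    using assms by (auto simp: q_null_def)
  have "n (u m + v m) \<le> C + C'" for m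
    using n_add[of "u m" "v m"] C[of m] by simp
  moreover have "(\<lambda>m. q (u m + v m)) \<longlonglongrightarrow> 0"
  proof (rule tendsto_sandwich[of "\<lambda>m. 0" _ _ "\<lambda>m. q (u m) + q (v m)"])
    show "(\<lambda>m. q (u m) + q (v m)) \<longlonglongrightarrow> 0"
      using tendsto_add[of "\<lambda>m. q (u m)" 0 sequentially "\<lambda>m. q (v m)" 0] assms
      by (simp add: q_null_def)
  qed (auto intro!: always_eventually q_add)
  ultimately show ?thesis by (auto simp: q_null_def)
qed

lemma q_null_scale:
  assumes "q_null v"
  shows "q_null (\<lambda>m. s c (v m))"
proof -
  note [simp] = q_null_in[OF assms]
  obtain C where C: "\<And>m. n (v m) \<le> C" using assms by (auto simp: q_null_def)
  have "n (s c (v m)) \<le> norm c * C" for m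
    using C[of m] by (simp add: n_scale mult_left_mono)
  moreover have "(\<lambda>m. q (s c (v m))) \<longlonglongrightarrow> 0"
    using ennreal_tendsto_cmult[of "ennreal (norm c)" "\<lambda>m. q (v m)" 0 sequentially] assms
    by (simp add: q_null_def q_scale)
  ultimately show ?thesis by (auto simp: q_null_def)
qed

lemma q_null_diff: "q_null u \<Longrightarrow> q_null v \<Longrightarrow> q_null (\<lambda>m. u m - v m)"
  using q_null_add[of u "\<lambda>m. s (-1) (v m)"] q_null_scale[of v "-1"] by simp

lemma q_null_eventually_le:
  assumes "q_null v" "0 < \<tau>"
  shows "\<forall>\<^sub>F m in sequentially. q (v m) \<le> ennreal \<tau>"
proof -
  have "\<forall>\<^sub>F m in sequentially. q (v m) < ennreal \<tau>"
    using assms by (intro order_tendstoD(2)[of _ 0]) (auto simp: q_null_def)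
  then show ?thesis by (rule eventually_mono) simp
qed

text \<open>
  Otherwise \<open>\<bar>\<phi> (u m)\<bar> \<ge> \<eta>\<close> for infinitely many \<open>m\<close>. A sum of \<open>i\<close> such vectors, rotated so that \<open>\<phi>\<close> is
  positive on them and selected one after the other by \<open>glide\<close>, has norm at most \<open>C + i \<epsilon>\<close> while
  \<open>\<phi>\<close> is at least \<open>i \<eta>\<close> on it. If \<open>\<epsilon>\<close> is small against \<open>\<eta>\<close> this contradicts boundedness of
  \<open>\<phi>\<close> for large \<open>i\<close>.
\<close>

lemma dual_q_null:
  assumes \<phi>: "\<phi> \<in> D" and u: "q_null u" "range u \<subseteq> U"
  shows "(\<lambda>m. \<phi> (u m)) \<longlonglongrightarrow> 0"
proof (rule ccontr)
  assume "\<not> ?thesis"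
  then obtain \<eta> where \<eta>: "0 < \<eta>" "\<not> (\<forall>\<^sub>F m in sequentially. norm (\<phi> (u m)) < \<eta>)"
    by (auto simp: tendsto_iff)
  then have freq: "\<exists>\<^sub>F m in sequentially. \<eta> \<le> norm (\<phi> (u m))"
    by (simp add: frequently_def not_le)
  obtain B where B: "0 \<le> B" "\<And>x. x \<in> W \<Longrightarrow> norm (\<phi> x) \<le> B * n x"
    using dual_bound[OF \<phi>] by blast
  obtain C where C: "\<And>m. n (u m) \<le> C" using u by (auto simp: q_null_def)
  have C0: "0 \<le> C" using C[of 0] n_ge0[OF q_null_in[OF u(1), of 0]] by linarith
  define \<epsilon> where "\<epsilon> = \<eta> / (2 * (B + 1))"
  have \<epsilon>: "0 < \<epsilon>" "B * \<epsilon> \<le> \<eta> / 2"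
    using B(1) \<eta>(1) by (auto simp: \<epsilon>_def field_simps)
  have sum: "\<exists>f\<in>U. n f \<le> C + real i * \<epsilon> \<and> (\<exists>r. \<phi> f = of_real r \<and> real i * \<eta> \<le> r)" for i
  proof (induction i)
    case 0
    show ?case using C0 dual_zero[OF \<phi>] by (intro bexI[of _ 0]) (auto intro: exI[of _ 0])
  next
    case (Suc i)
    then obtain f r where f: "f \<in> U" "n f \<le> C + real i * \<epsilon>" "\<phi> f = of_real r" "real i * \<eta> \<le> r"
      by blast
    obtain \<tau> where \<tau>: "\<tau> > 0" "\<And>v. v \<in> W \<Longrightarrow> n v \<le> C + real i * \<epsilon> \<Longrightarrow> q v \<le> ennreal \<tau> \<Longrightarrow>
        n (f + v) \<le> C + real i * \<epsilon> + \<epsilon>"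
      using glide[OF f(1,2) \<epsilon>(1)] by blast
    obtain m where m: "\<eta> \<le> norm (\<phi> (u m))" "q (u m) \<le> ennreal \<tau>"
      using frequently_ex[OF frequently_eventually_conj[OF freq q_null_eventually_le[OF u(1) \<tau>(1)]]]
      by blast
    obtain \<theta> where \<theta>: "norm \<theta> = 1" "\<theta> * \<phi> (u m) = of_real (norm (\<phi> (u m)))"
      using unimodular_rotation .
    have um: "u m \<in> U" using u(2) by blast
    let ?v = "s \<theta> (u m)"
    have "n ?v \<le> C + real i * \<epsilon>" using um \<theta> C[of m] \<epsilon>(1) by (simp add: n_scale add_increasing2)
    then have "n (f + ?v) \<le> C + real i * \<epsilon> + \<epsilon>"
      using um \<theta> m(2) by (intro \<tau>(2)) (auto simp: q_scale)
    moreover have "\<phi> (f + ?v) = of_real (r + norm (\<phi> (u m)))"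
      using um f \<theta> by (simp add: dual_add[OF \<phi>] dual_scale[OF \<phi>])
    ultimately show ?case using um f m(1)
      by (intro bexI[of _ "f + ?v"]) (auto simp: algebra_simps intro!: exI[of _ "r + norm (\<phi> (u m))"])
  qed
  obtain i :: nat where i: "B * C < real i * (\<eta> / 2)"
    using reals_Archimedean3[of "\<eta> / 2"] \<eta>(1) by auto
  obtain f r where f: "f \<in> U" "n f \<le> C + real i * \<epsilon>" "\<phi> f = of_real r" "real i * \<eta> \<le> r"
    using sum by blast
  have "real i * \<eta> \<le> norm (\<phi> f)" using f(3,4) by simp
  also have "\<dots> \<le> B * n f" using f(1) by (intro B(2)) simp
  also have "\<dots> \<le> B * (C + real i * \<epsilon>)" using f(2) B(1) by (rule mult_left_mono)
  also have "\<dots> = B * C + real i * (B * \<epsilon>)" by (simp add: algebra_simps)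
  also have "\<dots> \<le> B * C + real i * (\<eta> / 2)" using \<epsilon>(2) by (intro add_left_mono mult_left_mono) auto
  finally show False using i by simp
qed

lemma approx_scaled:
  assumes h: "h \<in> W" and \<epsilon>: "0 < \<epsilon>"
  shows "\<exists>g\<in>U. q (h - g) \<le> ennreal \<epsilon> \<and> n (h - g) \<le> n h + \<epsilon>"
proof (cases "n h = 0")
  case True
  then show ?thesis using n_eq0[OF h] \<epsilon> by (intro bexI[of _ 0]) auto
next
  case False
  then have c: "0 < n h" using n_ge0[OF h] by simp
  let ?c = "of_real (n h) :: 'k"
  have "n (s (inverse ?c) h) \<le> 1" using c h by (simp add: n_scale norm_inverse)
  then obtain g where g: "g \<in> U" "q (s (inverse ?c) h - g) \<le> ennreal (\<epsilon> / n h)"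
      "n (s (inverse ?c) h - g) \<le> 1 + \<epsilon> / n h"
    using approx[of "s (inverse ?c) h" "\<epsilon> / n h"] h \<epsilon> c by auto
  have eq: "h - s ?c g = s ?c (s (inverse ?c) h - g)"
    using c by (simp add: scale_right_diff_distrib)
  have "q (h - s ?c g) \<le> ennreal (n h) * ennreal (\<epsilon> / n h)"
    unfolding eq using g h c by (subst q_scale) (auto intro: mult_left_mono)
  also have "\<dots> = ennreal \<epsilon>" using c \<epsilon> by (simp flip: ennreal_mult)
  finally have "q (h - s ?c g) \<le> ennreal \<epsilon>" .
  moreover have "n (h - s ?c g) \<le> n h * (1 + \<epsilon> / n h)"
    unfolding eq using g h c by (subst n_scale) (auto intro: mult_left_mono)
  then have "n (h - s ?c g) \<le> n h + \<epsilon>" using c by (simp add: distrib_left)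
  ultimately show ?thesis using g(1) by (intro bexI[of _ "s ?c g"]) auto
qed

definition appr :: "'v \<Rightarrow> nat \<Rightarrow> 'v" where
  "appr h m = (SOME g. g \<in> U \<and> q (h - g) \<le> ennreal (1 / Suc m) \<and> n (h - g) \<le> n h + 1 / Suc m)"

lemma appr:
  assumes "h \<in> W"
  shows "appr h m \<in> U" "q (h - appr h m) \<le> ennreal (1 / Suc m)"
    "n (h - appr h m) \<le> n h + 1 / Suc m"
proof -
  have "\<exists>g. g \<in> U \<and> q (h - g) \<le> ennreal (1 / Suc m) \<and> n (h - g) \<le> n h + 1 / Suc m"
    using approx_scaled[OF assms, of "1 / Suc m"] by auto
  from someI_ex[OF this]
  show "appr h m \<in> U" "q (h - appr h m) \<le> ennreal (1 / Suc m)"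
    "n (h - appr h m) \<le> n h + 1 / Suc m"
    by (auto simp: appr_def)
qed

lemma q_null_appr:
  assumes "h \<in> W"
  shows "q_null (\<lambda>m. h - appr h m)"
proof -
  have "n (h - appr h m) \<le> n h + 1" for m
    by (rule order_trans[OF appr(3)[OF assms, of m]]) simp
  moreover have "(\<lambda>m. q (h - appr h m)) \<longlonglongrightarrow> 0"
  proof (rule tendsto_sandwich[of "\<lambda>m. 0" _ _ "\<lambda>m. ennreal (1 / Suc m)"])
    show "(\<lambda>m. ennreal (1 / Suc m)) \<longlonglongrightarrow> 0"
      using tendsto_ennrealI[OF LIMSEQ_Suc[OF lim_1_over_n[where 'a = real]]] by simp
  qed (use appr(2)[OF assms] in \<open>simp_all add: always_eventually\<close>)
  ultimately show ?thesis using assms appr(1)[OF assms] by (auto simp: q_null_def)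
qed

definition P :: "('v \<Rightarrow> 'k) \<Rightarrow> 'v \<Rightarrow> 'k" where
  "P \<phi> h = (if h \<in> W then lim (\<lambda>m. \<phi> (h - appr h m)) else 0)"

lemma P_appr:
  assumes \<phi>: "\<phi> \<in> D" and h: "h \<in> W"
  shows "(\<lambda>m. \<phi> (h - appr h m)) \<longlonglongrightarrow> P \<phi> h"
proof -
  \<comment> \<open>Two index sequences that refute the Cauchy property give a null sequence in \<open>U\<close> on which
    \<open>\<phi>\<close> stays large.\<close>
  have "Cauchy (\<lambda>m. \<phi> (h - appr h m))"
  proof (rule ccontr)
    assume "\<not> ?thesis"
    then obtain \<eta> where \<eta>: "0 < \<eta>"
      "\<And>M. \<exists>i\<ge>M. \<exists>j\<ge>M. \<eta> \<le> norm (\<phi> (h - appr h i) - \<phi> (h - appr h j))"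
      unfolding Cauchy_iff by (meson not_le)
    then obtain i j where ij: "\<And>M. i M \<ge> M" "\<And>M. j M \<ge> M"
      "\<And>M. \<eta> \<le> norm (\<phi> (h - appr h (i M)) - \<phi> (h - appr h (j M)))"
      by metis
    have sub: "q_null (\<lambda>M. h - appr h (k M))" if "\<And>M. k M \<ge> M" for k :: "nat \<Rightarrow> nat"
    proof -
      have "filterlim k at_top sequentially"
        using that by (intro filterlim_at_top_mono[OF filterlim_ident]) auto
      then show ?thesis
        using q_null_appr[OF h] filterlim_compose[of "\<lambda>m. q (h - appr h m)" _ sequentially k]
        by (auto simp: q_null_def)
    qed
    have "q_null (\<lambda>M. (h - appr h (i M)) - (h - appr h (j M)))"
      by (intro q_null_diff sub ij)
    then have "(\<lambda>M. \<phi> ((h - appr h (i M)) - (h - appr h (j M)))) \<longlonglongrightarrow> 0"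
      using appr(1)[OF h] by (intro dual_q_null[OF \<phi>]) auto
    then have "\<forall>\<^sub>F M in sequentially. norm (\<phi> ((h - appr h (i M)) - (h - appr h (j M)))) < \<eta>"
      using \<eta>(1) by (auto simp: tendsto_iff)
    then obtain M where "norm (\<phi> ((h - appr h (i M)) - (h - appr h (j M)))) < \<eta>"
      using eventually_happens sequentially_bot by blast
    then show False using ij(3)[of M] h appr(1)[OF h]
      by (simp add: dual_diff[OF \<phi>])
  qed
  then show ?thesis using h by (simp add: P_def Cauchy_convergent_iff convergent_LIMSEQ_iff)
qed

text \<open>
  Two approximating sequences of \<open>h\<close> differ by a sequence in \<open>U\<close> to which \<open>dual_q_null\<close> applies.
  The freedom in choosing \<open>g\<close> is what makes \<open>P \<phi>\<close> linear and zero on \<open>U\<close>.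
\<close>

lemma P_tendsto:
  assumes \<phi>: "\<phi> \<in> D" and h: "h \<in> W" and g: "range g \<subseteq> U" "q_null (\<lambda>m. h - g m)"
  shows "(\<lambda>m. \<phi> (h - g m)) \<longlonglongrightarrow> P \<phi> h"
proof -
  have gU: "g m \<in> U" for m using g(1) by blast
  have "(\<lambda>m. \<phi> ((h - g m) - (h - appr h m))) \<longlonglongrightarrow> 0"
    using gU appr(1)[OF h] q_null_diff[OF g(2) q_null_appr[OF h]]
    by (intro dual_q_null[OF \<phi>]) auto
  from tendsto_add[OF this P_appr[OF \<phi> h]] show ?thesis
    using h gU appr(1)[OF h] by (simp add: dual_diff[OF \<phi>])
qed

lemma norm_P_le:
  assumes \<phi>: "\<phi> \<in> D" and h: "h \<in> W"
  shows "norm (P \<phi> h) \<le> dual_norm W n \<phi> * n h"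
proof -
  have "norm (P \<phi> h) \<le> dual_norm W n \<phi> * (n h + 0)"
  proof (rule LIMSEQ_le[OF tendsto_norm[OF P_appr[OF \<phi> h]]])
    show "(\<lambda>m. dual_norm W n \<phi> * (n h + 1 / Suc m)) \<longlonglongrightarrow> dual_norm W n \<phi> * (n h + 0)"
      by (intro tendsto_intros LIMSEQ_Suc[OF lim_1_over_n])
    have "norm (\<phi> (h - appr h m)) \<le> dual_norm W n \<phi> * (n h + 1 / Suc m)" for m
      using order_trans[OF norm_le_dual_norm[OF \<phi>] mult_left_mono[OF appr(3)[OF h] dual_norm_ge0[OF \<phi>]]]
        h appr(1)[OF h] by simp
    then show "\<exists>N. \<forall>m\<ge>N. norm (\<phi> (h - appr h m)) \<le> dual_norm W n \<phi> * (n h + 1 / Suc m)"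
      by blast
  qed
  then show ?thesis by simp
qed

lemma P_in_dual:
  assumes \<phi>: "\<phi> \<in> D"
  shows "P \<phi> \<in> D"
proof (rule dualI)
  fix x y assume x: "x \<in> W" and y: "y \<in> W"
  note [simp] = appr(1)[OF x] appr(1)[OF y]
  have eq: "x + y - (appr x m + appr y m) = (x - appr x m) + (y - appr y m)" for m
    by (simp add: algebra_simps)
  have "(\<lambda>m. \<phi> (x + y - (appr x m + appr y m))) \<longlonglongrightarrow> P \<phi> (x + y)"
  proof (rule P_tendsto[OF \<phi>])
    show "q_null (\<lambda>m. x + y - (appr x m + appr y m))"
      unfolding eq by (intro q_null_add q_null_appr x y)
  qed (use x y in auto)
  moreover have "(\<lambda>m. \<phi> (x + y - (appr x m + appr y m))) \<longlonglongrightarrow> P \<phi> x + P \<phi> y"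
    unfolding eq using tendsto_add[OF P_appr[OF \<phi> x] P_appr[OF \<phi> y]] x y
    by (simp add: dual_add[OF \<phi>])
  ultimately show "P \<phi> (x + y) = P \<phi> x + P \<phi> y" by (rule LIMSEQ_unique)
next
  fix c x assume x: "x \<in> W"
  note [simp] = appr(1)[OF x]
  have eq: "s c x - s c (appr x m) = s c (x - appr x m)" for m
    by (simp add: scale_right_diff_distrib)
  have "(\<lambda>m. \<phi> (s c x - s c (appr x m))) \<longlonglongrightarrow> P \<phi> (s c x)"
  proof (rule P_tendsto[OF \<phi>])
    show "q_null (\<lambda>m. s c x - s c (appr x m))"
      unfolding eq by (intro q_null_scale q_null_appr x)
  qed (use x in auto)
  moreover have "(\<lambda>m. \<phi> (s c x - s c (appr x m))) \<longlonglongrightarrow> c * P \<phi> x"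
    unfolding eq using tendsto_mult_left[OF P_appr[OF \<phi> x], of c] x
    by (simp add: dual_scale[OF \<phi>])
  ultimately show "P \<phi> (s c x) = c * P \<phi> x" by (rule LIMSEQ_unique)
qed (use norm_P_le[OF \<phi>] in \<open>auto simp: P_def\<close>)

lemma P_vanishes:
  assumes \<phi>: "\<phi> \<in> D" and u: "u \<in> U"
  shows "P \<phi> u = 0"
proof -
  have "(\<lambda>m. \<phi> (u - u)) \<longlonglongrightarrow> P \<phi> u"
    using u q_null_zero by (intro P_tendsto[OF \<phi>]) auto
  then show ?thesis by (simp add: dual_zero[OF \<phi>] LIMSEQ_const_iff)
qed

lemma P_annihilator:
  assumes "\<phi> \<in> annihilator s W n U"
  shows "P \<phi> = \<phi>"
proof
  have \<phi>: "\<phi> \<in> D" and van: "\<And>u. u \<in> U \<Longrightarrow> \<phi> u = 0"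
    using assms by (auto simp: annihilator_def)
  fix h
  show "P \<phi> h = \<phi> h"
  proof (cases "h \<in> W")
    case True
    then have "\<phi> (h - appr h m) = \<phi> h" for m
      using appr(1)[OF True] by (simp add: dual_diff[OF \<phi>] van)
    then show ?thesis using P_appr[OF \<phi> True] by (simp add: LIMSEQ_const_iff)
  next
    case False
    then show ?thesis by (simp add: P_def dual_outside[OF \<phi>])
  qed
qed

lemma P_range: "P ` D = annihilator s W n U"
proof
  show "P ` D \<subseteq> annihilator s W n U"
    by (auto simp: annihilator_def P_in_dual P_vanishes)
  show "annihilator s W n U \<subseteq> P ` D"
    using P_annihilator by (force simp: annihilator_def)
qed

lemma P_linear: "linear_map_on fun_scale fun_scale D P"
  unfolding linear_map_on_def
proof (intro conjI ballI allI ext)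
  fix \<phi> \<psi> h assume \<phi>: "\<phi> \<in> D" and \<psi>: "\<psi> \<in> D"
  show "P (\<phi> + \<psi>) h = (P \<phi> + P \<psi>) h"
    using limI[OF tendsto_add[OF P_appr[OF \<phi>] P_appr[OF \<psi>]], of h h] by (simp add: P_def)
next
  fix c \<phi> h assume \<phi>: "\<phi> \<in> D"
  show "P (fun_scale c \<phi>) h = fun_scale c (P \<phi>) h"
    using limI[OF tendsto_mult_left[OF P_appr[OF \<phi>]], of h c] by (simp add: P_def fun_scale_def)
qed

text \<open>
  The sum of \<open>i\<close> approximants of \<open>k\<close> has norm at most \<open>(i + 1) a\<close> with \<open>a\<close> close to \<open>1\<close>: the next
  approximant is \<open>k - v\<close> with \<open>v\<close> small in \<open>q\<close>, so subtracting \<open>v\<close> from the sum \<open>f\<close> costs only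
  \<open>\<epsilon> / 2\<close> by \<open>glide\<close>, and adding \<open>k\<close> costs at most \<open>1\<close>. Dividing by \<open>i\<close> makes the extra summand
  harmless. The start of the induction needs the bound \<open>a\<close> rather than \<open>0\<close> because \<open>glide\<close> wants a
  common bound for \<open>f\<close> and \<open>v\<close>.
\<close>

lemma averaged_approximant:
  assumes \<phi>: "\<phi> \<in> D" and k: "k \<in> W" "n k \<le> 1" and \<epsilon>: "0 < \<epsilon>"
  shows "\<exists>f\<in>U. n f \<le> 1 + \<epsilon> \<and> norm (\<phi> f - (\<phi> - P \<phi>) k) \<le> \<epsilon>"
proof -
  define a where "a = 1 + \<epsilon> / 2"
  have sum: "\<exists>f\<in>U. n f \<le> (real i + 1) * a \<and> norm (\<phi> f - of_nat i * (\<phi> - P \<phi>) k) \<le> real i * \<epsilon>" for i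
  proof (induction i)
    case 0
    show ?case using \<epsilon> by (intro bexI[of _ 0]) (auto simp: a_def dual_zero[OF \<phi>])
  next
    case (Suc i)
    then obtain f where f: "f \<in> U" "n f \<le> (real i + 1) * a"
        "norm (\<phi> f - of_nat i * (\<phi> - P \<phi>) k) \<le> real i * \<epsilon>"
      by blast
    have e2: "0 < \<epsilon> / 2" using \<epsilon> by simp
    obtain \<tau> where \<tau>: "\<tau> > 0" "\<And>v. v \<in> W \<Longrightarrow> n v \<le> (real i + 1) * a \<Longrightarrow> q v \<le> ennreal \<tau> \<Longrightarrow>
        n (f + v) \<le> (real i + 1) * a + \<epsilon> / 2"
      using glide[OF f(1,2) e2] by blast
    have "\<forall>\<^sub>F m in sequentially. norm (\<phi> (k - appr k m) - P \<phi> k) < \<epsilon>"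
      using P_appr[OF \<phi> k(1)] \<epsilon> by (auto simp: tendsto_iff dist_norm)
    moreover have "\<forall>\<^sub>F m in sequentially. 1 / Suc m < \<epsilon> / 2"
      using e2 LIMSEQ_Suc[OF lim_1_over_n[where 'a = real]] by (intro order_tendstoD) auto
    ultimately have "\<forall>\<^sub>F m in sequentially. norm (\<phi> (k - appr k m) - P \<phi> k) < \<epsilon> \<and>
        1 / Suc m < \<epsilon> / 2 \<and> q (k - appr k m) \<le> ennreal \<tau>"
      using q_null_eventually_le[OF q_null_appr[OF k(1)] \<tau>(1)] by eventually_elim blast
    then obtain m where m: "norm (\<phi> (k - appr k m) - P \<phi> k) < \<epsilon>" "1 / Suc m < \<epsilon> / 2"
        "q (k - appr k m) \<le> ennreal \<tau>"
      using eventually_happens sequentially_bot by blast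
    let ?g = "appr k m"
    have g: "?g \<in> U" by (rule appr(1)[OF k(1)])
    have "n (k - ?g) \<le> a" using appr(3)[OF k(1), of m] k(2) m(2) by (simp add: a_def)
    also have "\<dots> \<le> (real i + 1) * a" using \<epsilon> by (simp add: a_def mult_le_cancel_right1)
    finally have "n (- (k - ?g)) \<le> (real i + 1) * a" using g k by (subst n_minus) auto
    then have "n (f + - (k - ?g)) \<le> (real i + 1) * a + \<epsilon> / 2"
      using g k m(3) q_minus[of "k - ?g"] by (intro \<tau>(2)) auto
    moreover have "n (f + ?g) \<le> n (f + - (k - ?g)) + n k"
      using n_add[of "f + - (k - ?g)" k] f g k by (simp add: algebra_simps)
    ultimately have "n (f + ?g) \<le> (real (Suc i) + 1) * a"
      using k(2) by (simp add: a_def algebra_simps add_divide_distrib)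
    moreover have "norm (\<phi> (f + ?g) - of_nat (Suc i) * (\<phi> - P \<phi>) k) \<le> real (Suc i) * \<epsilon>"
    proof -
      have "\<phi> (f + ?g) - of_nat (Suc i) * (\<phi> - P \<phi>) k =
          (\<phi> f - of_nat i * (\<phi> - P \<phi>) k) - (\<phi> (k - ?g) - P \<phi> k)"
        using f g k by (simp add: dual_add[OF \<phi>] dual_diff[OF \<phi>] algebra_simps)
      also have "norm \<dots> \<le> real i * \<epsilon> + \<epsilon>"
        by (rule order_trans[OF norm_triangle_ineq4 add_mono[OF f(3) less_imp_le[OF m(1)]]])
      finally show ?thesis by (simp add: algebra_simps)
    qed
    ultimately show ?case using f g by (intro bexI[of _ "f + ?g"]) auto
  qed
  obtain i :: nat where i: "a < real i * (\<epsilon> / 2)"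
    using reals_Archimedean3[of "\<epsilon> / 2"] \<epsilon> by auto
  have i0: "0 < i" using i \<epsilon> by (cases i) (auto simp: a_def)
  obtain f where f: "f \<in> U" "n f \<le> (real i + 1) * a"
      "norm (\<phi> f - of_nat i * (\<phi> - P \<phi>) k) \<le> real i * \<epsilon>"
    using sum by blast
  let ?c = "inverse (of_nat i) :: 'k"
  have "n (s ?c f) = n f / real i" using f by (simp add: n_scale norm_inverse divide_inverse mult.commute)
  also have "\<dots> \<le> 1 + \<epsilon>"
    using f(2) i i0 by (simp add: divide_le_eq a_def algebra_simps add_divide_distrib)
  finally have "n (s ?c f) \<le> 1 + \<epsilon>" .
  moreover have "\<phi> (s ?c f) - (\<phi> - P \<phi>) k = ?c * (\<phi> f - of_nat i * (\<phi> - P \<phi>) k)"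
    using f i0 by (simp add: dual_scale[OF \<phi>] field_simps)
  then have "norm (\<phi> (s ?c f) - (\<phi> - P \<phi>) k) =
      norm (\<phi> f - of_nat i * (\<phi> - P \<phi>) k) / real i"
    by (simp only: norm_mult norm_inverse norm_of_nat divide_inverse mult.commute)
  then have "norm (\<phi> (s ?c f) - (\<phi> - P \<phi>) k) \<le> \<epsilon>"
    using f(3) i0 by (simp only: divide_le_eq) (simp add: mult.commute)
  ultimately show ?thesis using f(1) by (intro bexI[of _ "s ?c f"]) auto
qed

text \<open>
  Evaluate \<open>\<phi>\<close> at \<open>f + (h - g)\<close>, where \<open>f \<in> U\<close> represents \<open>k\<close> as in \<open>averaged_approximant\<close> and \<open>g\<close>
  is a late approximant of \<open>h\<close>; by \<open>glide\<close> this vector is almost in the unit ball.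
\<close>

lemma norm_glued_le:
  assumes \<phi>: "\<phi> \<in> D" and h: "h \<in> W" "n h \<le> 1" and k: "k \<in> W" "n k \<le> 1"
  shows "norm ((\<phi> - P \<phi>) k + P \<phi> h) \<le> dual_norm W n \<phi>"
proof -
  let ?N = "dual_norm W n \<phi>"
  have *: "norm ((\<phi> - P \<phi>) k + P \<phi> h) \<le> ?N * (1 + 2 * \<epsilon>) + \<epsilon>" if \<epsilon>: "0 < \<epsilon>" for \<epsilon>
  proof -
    obtain f where f: "f \<in> U" "n f \<le> 1 + \<epsilon>" "norm (\<phi> f - (\<phi> - P \<phi>) k) \<le> \<epsilon>"
      using averaged_approximant[OF \<phi> k \<epsilon>] by blast
    obtain \<tau> where \<tau>: "\<tau> > 0" "\<And>v. v \<in> W \<Longrightarrow> n v \<le> 1 + \<epsilon> \<Longrightarrow> q v \<le> ennreal \<tau> \<Longrightarrow>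
        n (f + v) \<le> 1 + \<epsilon> + \<epsilon>"
      using glide[OF f(1,2) \<epsilon>] by blast
    have "\<forall>\<^sub>F m in sequentially. 1 / Suc m < \<epsilon>"
      using \<epsilon> LIMSEQ_Suc[OF lim_1_over_n[where 'a = real]] by (intro order_tendstoD) auto
    then have "\<forall>\<^sub>F m in sequentially. norm (\<phi> f + \<phi> (h - appr h m)) \<le> ?N * (1 + 2 * \<epsilon>)"
      using q_null_eventually_le[OF q_null_appr[OF h(1)] \<tau>(1)]
    proof eventually_elim
      case (elim m)
      have "n (f + (h - appr h m)) \<le> 1 + 2 * \<epsilon>"
        using \<tau>(2)[of "h - appr h m"] elim appr[OF h(1), of m] h by simp
      then have "norm (\<phi> (f + (h - appr h m))) \<le> ?N * (1 + 2 * \<epsilon>)"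
        using norm_le_dual_norm[OF \<phi>, of "f + (h - appr h m)"] f h appr(1)[OF h(1), of m]
          mult_left_mono[OF _ dual_norm_ge0[OF \<phi>]] by (meson UW W_rules(2,3) order_trans)
      then show ?case using f h appr(1)[OF h(1), of m] by (simp add: dual_add[OF \<phi>])
    qed
    then have le: "norm (\<phi> f + P \<phi> h) \<le> ?N * (1 + 2 * \<epsilon>)"
      by (rule tendsto_upperbound[OF tendsto_norm[OF tendsto_add[OF tendsto_const P_appr[OF \<phi> h(1)]]]])
        simp
    have "(\<phi> - P \<phi>) k + P \<phi> h = (\<phi> f + P \<phi> h) - (\<phi> f - (\<phi> - P \<phi>) k)"
      by (simp add: algebra_simps)
    also have "norm \<dots> \<le> ?N * (1 + 2 * \<epsilon>) + \<epsilon>"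
      by (rule order_trans[OF norm_triangle_ineq4 add_mono[OF le f(3)]])
    finally show ?thesis .
  qed
  have "((\<lambda>\<epsilon>. ?N * (1 + 2 * \<epsilon>) + \<epsilon>) \<longlongrightarrow> ?N * (1 + 2 * 0) + 0) (at_right 0)"
    by (intro tendsto_intros)
  moreover have "\<forall>\<^sub>F \<epsilon> in at_right 0. norm ((\<phi> - P \<phi>) k + P \<phi> h) \<le> ?N * (1 + 2 * \<epsilon>) + \<epsilon>"
    using eventually_at_right_less[of "0::real"] by eventually_elim (rule *)
  ultimately show ?thesis
    using tendsto_lowerbound[of _ "?N * (1 + 2 * 0) + 0" "at_right (0::real)"] by force
qed

text \<open>
  Unimodular factors turn the sum in \<open>norm_glued_le\<close> into a sum of absolute values; then the suprema
  over \<open>h\<close> and \<open>k\<close> are taken separately.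
\<close>

lemma P_norm:
  assumes \<phi>: "\<phi> \<in> D"
  shows "dual_norm W n \<phi> = dual_norm W n (P \<phi>) + dual_norm W n (\<phi> - P \<phi>)"
proof (rule antisym)
  have P: "P \<phi> \<in> D" and Q: "\<phi> - P \<phi> \<in> D"
    using \<phi> by (auto intro: dual_space_diff P_in_dual)
  show "dual_norm W n \<phi> \<le> dual_norm W n (P \<phi>) + dual_norm W n (\<phi> - P \<phi>)"
  proof (rule dual_norm_le)
    fix x assume x: "x \<in> W" "n x \<le> 1"
    show "norm (\<phi> x) \<le> dual_norm W n (P \<phi>) + dual_norm W n (\<phi> - P \<phi>)"
      using norm_triangle_ineq[of "P \<phi> x" "(\<phi> - P \<phi>) x"]
        norm_le_dual_norm_unit[OF P x] norm_le_dual_norm_unit[OF Q x] by simp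
  qed
  have sum: "norm (P \<phi> h) + norm ((\<phi> - P \<phi>) k) \<le> dual_norm W n \<phi>"
    if h: "h \<in> W" "n h \<le> 1" and k: "k \<in> W" "n k \<le> 1" for h k
  proof -
    obtain \<theta> where \<theta>: "norm \<theta> = 1" "\<theta> * P \<phi> h = of_real (norm (P \<phi> h))"
      using unimodular_rotation .
    obtain \<zeta> where \<zeta>: "norm \<zeta> = 1" "\<zeta> * (\<phi> - P \<phi>) k = of_real (norm ((\<phi> - P \<phi>) k))"
      using unimodular_rotation .
    have "norm ((\<phi> - P \<phi>) (s \<zeta> k) + P \<phi> (s \<theta> h)) \<le> dual_norm W n \<phi>"
      using h k \<theta>(1) \<zeta>(1) by (intro norm_glued_le[OF \<phi>]) (auto simp: n_scale)
    moreover have "(\<phi> - P \<phi>) (s \<zeta> k) + P \<phi> (s \<theta> h) =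
        of_real (norm ((\<phi> - P \<phi>) k) + norm (P \<phi> h))"
      unfolding dual_scale[OF P h(1)] dual_scale[OF Q k(1)] \<theta>(2) \<zeta>(2) by simp
    ultimately have "norm (of_real (norm ((\<phi> - P \<phi>) k) + norm (P \<phi> h)) :: 'k) \<le> dual_norm W n \<phi>"
      by (simp only:)
    then show ?thesis unfolding norm_of_real by linarith
  qed
  have "dual_norm W n (\<phi> - P \<phi>) \<le> dual_norm W n \<phi> - dual_norm W n (P \<phi>)"
  proof (rule dual_norm_le)
    fix k assume k: "k \<in> W" "n k \<le> 1"
    have "dual_norm W n (P \<phi>) \<le> dual_norm W n \<phi> - norm ((\<phi> - P \<phi>) k)"
      by (rule dual_norm_le) (use sum[OF _ _ k] in \<open>simp add: le_diff_eq\<close>)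
    then show "norm ((\<phi> - P \<phi>) k) \<le> dual_norm W n \<phi> - dual_norm W n (P \<phi>)" by simp
  qed
  then show "dual_norm W n (P \<phi>) + dual_norm W n (\<phi> - P \<phi>) \<le> dual_norm W n \<phi>" by simp
qed

theorem annihilator_L_summand: "L_summand fun_scale D (dual_norm W n) (annihilator s W n U)"
  unfolding L_summand_def L_projection_def
proof (intro exI[of _ P] conjI ballI)
  show "P ` D \<subseteq> D" using P_in_dual by blast
  show "linear_map_on fun_scale fun_scale D P" by (rule P_linear)
  show "P (P \<phi>) = P \<phi>" if "\<phi> \<in> D" for \<phi>
    using P_annihilator P_range that by blast
  show "dual_norm W n \<phi> = dual_norm W n (P \<phi>) + dual_norm W n (\<phi> - P \<phi>)" if "\<phi> \<in> D" for \<phi>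
    by (rule P_norm[OF that])
  show "annihilator s W n U = P ` D" by (rule P_range[symmetric])
qed

end


section \<open>Lipschitz estimates as pointwise bounds\<close>

lemma vector_space_fun_scale:
  "vector_space (fun_scale :: 'k::real_normed_field \<Rightarrow> ('b \<Rightarrow> 'k) \<Rightarrow> 'b \<Rightarrow> 'k)"
  by unfold_locales (auto simp: fun_scale_def fun_eq_iff algebra_simps)

interpretation fun_scale: vector_space "fun_scale :: 'k::real_normed_field \<Rightarrow> ('b \<Rightarrow> 'k) \<Rightarrow> 'b \<Rightarrow> 'k"
  by (rule vector_space_fun_scale)

lemma sup_norm_le_iff: "0 \<le> C \<Longrightarrow> sup_norm f \<le> ennreal C \<longleftrightarrow> (\<forall>x. norm (f x) \<le> C)"
  by (simp add: sup_norm_def SUP_le_iff)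

lemma sup_norm_add: "sup_norm (f + g) \<le> sup_norm f + sup_norm g"
  unfolding sup_norm_def
proof (rule SUP_least)
  fix x
  have "ennreal (norm ((f + g) x)) \<le> ennreal (norm (f x)) + ennreal (norm (g x))"
    by (simp add: norm_triangle_ineq flip: ennreal_plus)
  also have "\<dots> \<le> (SUP x. ennreal (norm (f x))) + (SUP x. ennreal (norm (g x)))"
    by (intro add_mono SUP_upper) auto
  finally show "ennreal (norm ((f + g) x)) \<le> \<dots>" .
qed

lemma sup_norm_scale: "sup_norm (fun_scale c f) = ennreal (norm c) * sup_norm f"
  by (simp add: sup_norm_def fun_scale_def norm_mult ennreal_mult SUP_mult_left_ennreal)

lemma Lquot_le_iff: "x \<noteq> y \<Longrightarrow> Lquot x y f \<le> C \<longleftrightarrow> norm (f x - f y) \<le> C * dist x y"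
  by (simp add: Lquot_def divide_le_eq)

lemma Lconst_le_iff:
  assumes "0 \<le> C"
  shows "Lconst f \<le> ennreal C \<longleftrightarrow> (\<forall>x y. norm (f x - f y) \<le> C * dist x y)"
proof -
  have "Lconst f \<le> ennreal C \<longleftrightarrow> (\<forall>x y. x \<noteq> y \<longrightarrow> Lquot x y f \<le> C)"
    using assms by (auto simp: Lconst_def SUP_le_iff)
  also have "\<dots> \<longleftrightarrow> (\<forall>x y. norm (f x - f y) \<le> C * dist x y)"
    by (metis Lquot_le_iff diff_self dist_self mult_zero_right norm_zero order_refl)
  finally show ?thesis .
qed

lemma lip_condition_iff:
  "lip_condition f \<longleftrightarrow>
    (\<forall>\<epsilon>>0. \<exists>\<delta>>0. \<forall>x y. dist x y < \<delta> \<longrightarrow> norm (f x - f y) \<le> \<epsilon> * dist x y)"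
proof
  assume lip: "lip_condition f"
  show "\<forall>\<epsilon>>0. \<exists>\<delta>>0. \<forall>x y. dist x y < \<delta> \<longrightarrow> norm (f x - f y) \<le> \<epsilon> * dist x y"
  proof (intro allI impI)
    fix \<epsilon> :: real assume "0 < \<epsilon>"
    with lip obtain Q where Q: "eventually Q (at_right 0)" "\<And>x y. Q (dist x y) \<Longrightarrow> Lquot x y f < \<epsilon>"
      by (force simp: lip_condition_def tendsto_iff eventually_filtercomap Lquot_def)
    then obtain \<delta> where \<delta>: "0 < \<delta>" "\<And>t. 0 < t \<Longrightarrow> t < \<delta> \<Longrightarrow> Q t"
      by (auto simp: eventually_at_right_field)
    have "norm (f x - f y) \<le> \<epsilon> * dist x y" if "dist x y < \<delta>" for x y
    proof (cases "x = y")
      case False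
      then show ?thesis using Q(2)[OF \<delta>(2)[OF _ that]] Lquot_le_iff[OF False] by force
    qed simp
    then show "\<exists>\<delta>>0. \<forall>x y. dist x y < \<delta> \<longrightarrow> norm (f x - f y) \<le> \<epsilon> * dist x y"
      using \<delta>(1) by blast
  qed
next
  assume small: "\<forall>\<epsilon>>0. \<exists>\<delta>>0. \<forall>x y. dist x y < \<delta> \<longrightarrow> norm (f x - f y) \<le> \<epsilon> * dist x y"
  show "lip_condition f"
    unfolding lip_condition_def tendsto_iff
  proof (intro allI impI)
    fix \<epsilon> :: real assume \<epsilon>: "0 < \<epsilon>"
    then obtain \<delta> where \<delta>: "0 < \<delta>" "\<And>x y. dist x y < \<delta> \<Longrightarrow> norm (f x - f y) \<le> (\<epsilon> / 2) * dist x y"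
      using small by (metis half_gt_zero)
    have "dist (Lquot x y f) 0 < \<epsilon>" if xy: "0 < dist x y" "dist x y < \<delta>" for x y
    proof -
      have "Lquot x y f \<le> \<epsilon> / 2" using \<delta>(2)[OF xy(2)] xy(1) by (subst Lquot_le_iff) auto
      moreover have "0 \<le> Lquot x y f" by (simp add: Lquot_def)
      ultimately show ?thesis using \<epsilon> by simp
    qed
    then show "\<forall>\<^sub>F z in filtercomap (\<lambda>(x, y). dist x y) (at_right 0).
        dist (case z of (x, y) \<Rightarrow> Lquot x y f) 0 < \<epsilon>"
      unfolding eventually_filtercomap using \<delta>(1)
      by (intro exI[of _ "\<lambda>t. 0 < t \<and> t < \<delta>"]) (auto simp: eventually_at_right_field)
  qed
qed

text \<open>
  Both Lipschitz norms are the least \<open>C \<ge> 0\<close> with this property: for bounded Lipschitz functions \<open>A\<close> is the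
  whole space, and for functions vanishing at \<open>x0\<close> it is \<open>{x0}\<close>, where the first condition holds
  trivially.
\<close>

definition lip_le :: "'a::metric_space set \<Rightarrow> real \<Rightarrow> ('a \<Rightarrow> 'k::real_normed_field) \<Rightarrow> bool" where
  "lip_le A C f \<longleftrightarrow> (\<forall>x\<in>A. norm (f x) \<le> C) \<and> (\<forall>x y. norm (f x - f y) \<le> C * dist x y)"

lemma lip_le_mono: "lip_le A C f \<Longrightarrow> C \<le> C' \<Longrightarrow> lip_le A C' f"
  unfolding lip_le_def by (meson order_trans mult_right_mono zero_le_dist)

lemma lip_le_add:
  assumes "lip_le A C f" "lip_le A C' g"
  shows "lip_le A (C + C') (f + g)"
  unfolding lip_le_def
proof (intro conjI ballI allI)
  show "norm ((f + g) x) \<le> C + C'" if "x \<in> A" for x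
    using assms that by (auto simp: lip_le_def intro!: norm_triangle_mono)
  show "norm ((f + g) x - (f + g) y) \<le> (C + C') * dist x y" for x y
  proof -
    have "norm ((f x - f y) + (g x - g y)) \<le> C * dist x y + C' * dist x y"
      using assms by (intro norm_triangle_mono) (auto simp: lip_le_def)
    then show ?thesis by (simp add: algebra_simps)
  qed
qed

lemma lip_le_scale:
  assumes "lip_le A C f"
  shows "lip_le A (norm c * C) (fun_scale c f)"
  using assms
  by (auto simp: lip_le_def fun_scale_def norm_mult mult.assoc mult_left_mono
      simp flip: right_diff_distrib)

section \<open>Little Lipschitz functions in a Lipschitz space\<close>

text \<open>
  A common form of the two Lipschitz spaces: \<open>A\<close> is the set of points where the norm controls values,
  \<open>Z\<close> the set of prescribed zeros. Nonnegativity and symmetry of \<open>n\<close> are required of all functions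
  because \<^locale>\<open>Metric_space\<close> requires them of the distance off the carrier.
\<close>

locale lipschitz_space =
  fixes V :: "('a::metric_space \<Rightarrow> 'k::{real_normed_field,banach}) set"
    and n :: "('a \<Rightarrow> 'k) \<Rightarrow> real" and A Z :: "'a set"
  assumes A_nonempty: "A \<noteq> {}"
    and mem_iff: "f \<in> V \<longleftrightarrow> (\<exists>C\<ge>0. lip_le A C f) \<and> (\<forall>z\<in>Z. f z = 0)"
    and n_le_iff: "f \<in> V \<Longrightarrow> 0 \<le> C \<Longrightarrow> n f \<le> C \<longleftrightarrow> lip_le A C f"
    and n_ge0: "0 \<le> n f"
    and n_uminus: "n (- f) = n f"
begin

definition little :: "('a \<Rightarrow> 'k) set" where
  "little = {f \<in> V. lip_condition f}"

lemma lip_le_n: "f \<in> V \<Longrightarrow> lip_le A (n f) f"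
  using n_le_iff[of f "n f"] n_ge0 by simp

lemma n_leI: "f \<in> V \<Longrightarrow> lip_le A C f \<Longrightarrow> 0 \<le> C \<Longrightarrow> n f \<le> C"
  by (simp add: n_le_iff)

lemma quotient_bound: "f \<in> V \<Longrightarrow> norm (f x - f y) \<le> n f * dist x y"
  using lip_le_n by (auto simp: lip_le_def)

lemma subspace_V: "fun_scale.subspace V"
proof (rule fun_scale.subspaceI)
  show "0 \<in> V" by (auto simp: mem_iff lip_le_def intro!: exI[of _ 0])
  show "f + g \<in> V" if "f \<in> V" "g \<in> V" for f g
  proof -
    have "lip_le A (n f + n g) (f + g)" by (intro lip_le_add lip_le_n that)
    moreover have "0 \<le> n f + n g" using n_ge0[of f] n_ge0[of g] by simp
    moreover have "\<forall>z\<in>Z. (f + g) z = 0" using that by (simp add: mem_iff)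
    ultimately show ?thesis unfolding mem_iff by blast
  qed
  show "fun_scale c f \<in> V" if "f \<in> V" for c f
  proof -
    have "lip_le A (norm c * n f) (fun_scale c f)" by (intro lip_le_scale lip_le_n that)
    moreover have "0 \<le> norm c * n f" using n_ge0[of f] by simp
    moreover have "\<forall>z\<in>Z. fun_scale c f z = 0" using that by (simp add: mem_iff fun_scale_def)
    ultimately show ?thesis unfolding mem_iff by blast
  qed
qed

lemmas V_rules [simp] = fun_scale.subspace_0[OF subspace_V] fun_scale.subspace_add[OF subspace_V]
  fun_scale.subspace_diff[OF subspace_V] fun_scale.subspace_scale[OF subspace_V]
  fun_scale.subspace_neg[OF subspace_V]

lemma n_add: "f \<in> V \<Longrightarrow> g \<in> V \<Longrightarrow> n (f + g) \<le> n f + n g"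
  by (intro n_leI lip_le_add lip_le_n add_nonneg_nonneg n_ge0) auto

lemma n_scale_le: "f \<in> V \<Longrightarrow> n (fun_scale c f) \<le> norm c * n f"
  by (intro n_leI lip_le_scale lip_le_n mult_nonneg_nonneg n_ge0) auto

lemma n_eq_0_iff:
  assumes "f \<in> V"
  shows "n f = 0 \<longleftrightarrow> f = 0"
proof
  assume "n f = 0"
  then have 0: "lip_le A 0 f" using lip_le_n[OF assms] by simp
  obtain a where a: "a \<in> A" using A_nonempty by blast
  have "f a = 0" using 0 a by (simp add: lip_le_def)
  moreover have "f x = f a" for x
  proof -
    have "norm (f x - f a) \<le> 0 * dist x a" using 0 unfolding lip_le_def by blast
    then show ?thesis by simp
  qed
  ultimately show "f = 0" by (simp add: fun_eq_iff)
next
  assume "f = 0"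
  then have "n f \<le> 0" using assms by (intro n_leI) (auto simp: lip_le_def)
  then show "n f = 0" using n_ge0[of f] by simp
qed

lemma n_scale:
  assumes "f \<in> V"
  shows "n (fun_scale c f) = norm c * n f"
proof (cases "c = 0")
  case True
  then show ?thesis using n_eq_0_iff[of 0] by simp
next
  case False
  have "n (fun_scale (inverse c) (fun_scale c f)) \<le> norm (inverse c) * n (fun_scale c f)"
    using assms by (intro n_scale_le) simp
  then have "norm c * n f \<le> n (fun_scale c f)"
    using False by (simp add: norm_divide inverse_eq_divide pos_le_divide_eq mult.commute)
  then show ?thesis using n_scale_le[OF assms, of c] by simp
qed

lemma Metric_space_V: "Metric_space V (norm_dist n)"
proof
  fix f g h
  show "0 \<le> norm_dist n f g" by (simp add: norm_dist_def n_ge0)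
  show "norm_dist n f g = norm_dist n g f"
    using n_uminus[of "f - g"] by (simp add: norm_dist_def)
  show "norm_dist n f g = 0 \<longleftrightarrow> f = g" if "f \<in> V" "g \<in> V"
    using that by (simp add: norm_dist_def n_eq_0_iff)
  show "norm_dist n f h \<le> norm_dist n f g + norm_dist n g h" if "f \<in> V" "g \<in> V" "h \<in> V"
    using n_add[of "f - g" "g - h"] that by (simp add: norm_dist_def)
qed

lemma point_bound:
  assumes f: "f \<in> V" and a: "a \<in> A"
  shows "norm (f x) \<le> n f * (1 + dist x a)"
proof -
  have "norm (f x) \<le> norm (f a) + norm (f x - f a)" by (metis norm_triangle_sub)
  also have "\<dots> \<le> n f + n f * dist x a"
    using lip_le_n[OF f] a by (intro add_mono) (auto simp: lip_le_def)
  finally show ?thesis by (simp add: algebra_simps)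
qed

text \<open>
  A Cauchy sequence converges pointwise by \<open>point_bound\<close>, and the bounds \<^const>\<open>lip_le\<close> for the
  differences \<open>\<sigma> i - \<sigma> j\<close> pass to the pointwise limit in \<open>j\<close>.
\<close>

lemma mcomplete_V: "Metric_space.mcomplete V (norm_dist n)"
proof -
  interpret M: Metric_space V "norm_dist n" by (rule Metric_space_V)
  show ?thesis
    unfolding M.mcomplete_def
  proof (intro allI impI)
    fix \<sigma> assume "M.MCauchy \<sigma>"
    then have V: "\<sigma> m \<in> V" for m by (auto simp: M.MCauchy_def)
    from \<open>M.MCauchy \<sigma>\<close> have cau: "\<exists>N. \<forall>i\<ge>N. \<forall>j\<ge>N. n (\<sigma> i - \<sigma> j) < \<epsilon>" if "0 < \<epsilon>" for \<epsilon>
      using that unfolding M.MCauchy_def norm_dist_def by meson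
    obtain a where a: "a \<in> A" using A_nonempty by blast
    have "convergent (\<lambda>m. \<sigma> m x)" for x
    proof -
      have "Cauchy (\<lambda>m. \<sigma> m x)"
      proof (rule CauchyI)
        fix e :: real assume e: "0 < e"
        have pos: "0 < 1 + dist x a" by (simp add: add_pos_nonneg)
        then obtain N where N: "\<And>i j. i \<ge> N \<Longrightarrow> j \<ge> N \<Longrightarrow> n (\<sigma> i - \<sigma> j) < e / (1 + dist x a)"
          using cau[of "e / (1 + dist x a)"] e by auto
        have "norm (\<sigma> i x - \<sigma> j x) < e" if "i \<ge> N" "j \<ge> N" for i j
          using point_bound[of "\<sigma> i - \<sigma> j" a x] N[OF that] V a pos by (simp add: field_simps)
        then show "\<exists>N. \<forall>i\<ge>N. \<forall>j\<ge>N. norm (\<sigma> i x - \<sigma> j x) < e" by blast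
      qed
      then show ?thesis by (rule Cauchy_convergent)
    qed
    then obtain g where g: "\<And>x. (\<lambda>m. \<sigma> m x) \<longlonglongrightarrow> g x"
      unfolding convergent_def by metis
    have close: "\<exists>N. \<forall>i\<ge>N. lip_le A \<epsilon> (\<sigma> i - g)" if "0 < \<epsilon>" for \<epsilon>
    proof -
      obtain N where N: "\<And>i j. i \<ge> N \<Longrightarrow> j \<ge> N \<Longrightarrow> n (\<sigma> i - \<sigma> j) < \<epsilon>"
        using cau[OF \<open>0 < \<epsilon>\<close>] by blast
      have "lip_le A \<epsilon> (\<sigma> i - g)" if i: "i \<ge> N" for i
      proof -
        have le: "lip_le A \<epsilon> (\<sigma> i - \<sigma> j)" if "j \<ge> N" for j
          using lip_le_mono[OF lip_le_n less_imp_le[OF N[OF i that]]] V by simp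
        have "norm (\<sigma> i x - g x) \<le> \<epsilon>" if "x \<in> A" for x
        proof (rule LIMSEQ_le_const2[OF tendsto_norm[OF tendsto_diff[OF tendsto_const g]]])
          show "\<exists>N. \<forall>j\<ge>N. norm (\<sigma> i x - \<sigma> j x) \<le> \<epsilon>"
            using le that by (auto simp: lip_le_def)
        qed
        moreover have "norm ((\<sigma> i x - g x) - (\<sigma> i y - g y)) \<le> \<epsilon> * dist x y" for x y
        proof (rule LIMSEQ_le_const2[OF tendsto_norm[OF tendsto_diff[OF
                  tendsto_diff[OF tendsto_const g] tendsto_diff[OF tendsto_const g]]]])
          show "\<exists>N. \<forall>j\<ge>N. norm ((\<sigma> i x - \<sigma> j x) - (\<sigma> i y - \<sigma> j y)) \<le> \<epsilon> * dist x y"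
            using le unfolding lip_le_def fun_diff_def by blast
        qed
        ultimately show ?thesis by (simp add: lip_le_def)
      qed
      then show ?thesis by blast
    qed
    have zero: "g z = 0" if "z \<in> Z" for z
      using g[of z] V that by (simp add: mem_iff LIMSEQ_const_iff)
    have diff_V: "\<sigma> i - g \<in> V" if "lip_le A \<epsilon> (\<sigma> i - g)" "0 < \<epsilon>" for i \<epsilon>
      using that zero V[of i] unfolding mem_iff by (auto intro!: exI[of _ \<epsilon>])
    obtain N where "lip_le A 1 (\<sigma> N - g)" using close[of 1] by auto
    then have "\<sigma> N - (\<sigma> N - g) \<in> V"
      using diff_V[of 1 N] V[of N] fun_scale.subspace_diff[OF subspace_V, of "\<sigma> N" "\<sigma> N - g"] by auto
    then have gV: "g \<in> V" by simp
    have "\<exists>N. \<forall>m\<ge>N. \<sigma> m \<in> V \<and> norm_dist n (\<sigma> m) g < \<epsilon>" if \<epsilon>: "0 < \<epsilon>" for \<epsilon>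
    proof -
      obtain N where N: "\<And>i. i \<ge> N \<Longrightarrow> lip_le A (\<epsilon> / 2) (\<sigma> i - g)"
        using close[of "\<epsilon> / 2"] \<epsilon> by auto
      have "n (\<sigma> m - g) < \<epsilon>" if "m \<ge> N" for m
        using n_leI[OF _ N[OF that]] V gV \<epsilon> by fastforce
      then show ?thesis using V unfolding norm_dist_def by blast
    qed
    then show "\<exists>g. limitin M.mtopology \<sigma> g sequentially"
      using gV by (auto simp: M.limit_metric_sequentially)
  qed
qed

lemma littleE:
  assumes "f \<in> little" "0 < \<epsilon>"
  obtains \<delta> where "0 < \<delta>" "\<And>x y. dist x y < \<delta> \<Longrightarrow> norm (f x - f y) \<le> \<epsilon> * dist x y"
  using assms by (auto simp: little_def lip_condition_iff)

lemma subspace_little: "fun_scale.subspace little"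
proof (rule fun_scale.subspaceI)
  show "0 \<in> little" by (auto simp: little_def lip_condition_iff intro!: exI[of _ 1])
next
  fix f g assume fg: "f \<in> little" "g \<in> little"
  have "\<exists>\<delta>>0. \<forall>x y. dist x y < \<delta> \<longrightarrow> norm ((f + g) x - (f + g) y) \<le> \<epsilon> * dist x y"
    if "0 < \<epsilon>" for \<epsilon>
  proof -
    have e2: "0 < \<epsilon> / 2" using that by simp
    obtain d1 where d1: "0 < d1" "\<And>x y. dist x y < d1 \<Longrightarrow> norm (f x - f y) \<le> (\<epsilon> / 2) * dist x y"
      using littleE[OF fg(1) e2] by blast
    obtain d2 where d2: "0 < d2" "\<And>x y. dist x y < d2 \<Longrightarrow> norm (g x - g y) \<le> (\<epsilon> / 2) * dist x y"
      using littleE[OF fg(2) e2] by blast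
    have "norm ((f x - f y) + (g x - g y)) \<le> (\<epsilon> / 2) * dist x y + (\<epsilon> / 2) * dist x y"
      if "dist x y < min d1 d2" for x y
      using that by (intro norm_triangle_mono d1 d2) auto
    then show ?thesis using d1(1) d2(1)
      by (intro exI[of _ "min d1 d2"]) (auto simp: algebra_simps)
  qed
  then show "f + g \<in> little" using fg by (auto simp: little_def lip_condition_iff)
next
  fix c f assume f: "f \<in> little"
  have "\<exists>\<delta>>0. \<forall>x y. dist x y < \<delta> \<longrightarrow> norm (fun_scale c f x - fun_scale c f y) \<le> \<epsilon> * dist x y"
    if \<epsilon>: "0 < \<epsilon>" for \<epsilon>
  proof -
    have "0 < \<epsilon> / (norm c + 1)" using \<epsilon> by (simp add: add_nonneg_pos)
    then obtain \<delta> where \<delta>: "0 < \<delta>"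
      "\<And>x y. dist x y < \<delta> \<Longrightarrow> norm (f x - f y) \<le> \<epsilon> / (norm c + 1) * dist x y"
      using littleE[OF f] by blast
    have "norm (fun_scale c f x - fun_scale c f y) \<le> \<epsilon> * dist x y" if "dist x y < \<delta>" for x y
    proof -
      have "norm (fun_scale c f x - fun_scale c f y) = norm c * norm (f x - f y)"
        by (simp add: fun_scale_def norm_mult flip: right_diff_distrib)
      also have "\<dots> \<le> (norm c + 1) * (\<epsilon> / (norm c + 1) * dist x y)"
        using \<delta>(2)[OF that] by (intro mult_mono) auto
      also have "\<dots> = \<epsilon> * dist x y"
        using norm_ge_zero[of c] by (simp add: add_nonneg_eq_0_iff)
      finally show ?thesis .
    qed
    then show ?thesis using \<delta>(1) by blast
  qed
  then show "fun_scale c f \<in> little" using f by (auto simp: little_def lip_condition_iff)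
qed

lemma little_limit_point:
  assumes f: "f \<in> V" and lim: "\<And>r. 0 < r \<Longrightarrow> \<exists>g\<in>little. n (f - g) < r"
  shows "f \<in> little"
proof -
  have "\<exists>\<delta>>0. \<forall>x y. dist x y < \<delta> \<longrightarrow> norm (f x - f y) \<le> \<epsilon> * dist x y" if "0 < \<epsilon>" for \<epsilon>
  proof -
    have e2: "0 < \<epsilon> / 2" using that by simp
    obtain g where g: "g \<in> little" "n (f - g) < \<epsilon> / 2" using lim[OF e2] by blast
    obtain \<delta> where \<delta>: "0 < \<delta>" "\<And>x y. dist x y < \<delta> \<Longrightarrow> norm (g x - g y) \<le> (\<epsilon> / 2) * dist x y"
      using littleE[OF g(1) e2] by blast
    have "norm (f x - f y) \<le> \<epsilon> * dist x y" if "dist x y < \<delta>" for x y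
    proof -
      have "norm ((f - g) x - (f - g) y) \<le> (\<epsilon> / 2) * dist x y"
        using quotient_bound[of "f - g" x y] f g
          mult_right_mono[of "n (f - g)" "\<epsilon> / 2" "dist x y"] by (auto simp: little_def)
      from norm_triangle_mono[OF this \<delta>(2)[OF that]] show ?thesis by (simp add: algebra_simps)
    qed
    then show ?thesis using \<delta>(1) by blast
  qed
  then show ?thesis using f by (auto simp: little_def lip_condition_iff)
qed

text \<open>
  Below the distance \<open>\<delta>\<close> the difference quotients of \<open>f\<close> are at most \<open>\<epsilon>\<close>; from \<open>\<delta>\<close> on those of
  \<open>v\<close> are at most \<open>2 \<tau> / \<delta> \<le> \<epsilon>\<close>. So at every distance only one of the two functions contributes
  more than \<open>\<epsilon>\<close>.
\<close>

lemma little_glide: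
  assumes f: "f \<in> little" "n f \<le> C" and \<epsilon>: "0 < \<epsilon>"
  shows "\<exists>\<tau>>0. \<forall>v\<in>V. n v \<le> C \<longrightarrow> sup_norm v \<le> ennreal \<tau> \<longrightarrow> n (f + v) \<le> C + \<epsilon>"
proof -
  have fV: "f \<in> V" and C: "0 \<le> C" using f n_ge0[of f] by (auto simp: little_def)
  obtain \<delta> where \<delta>: "0 < \<delta>" "\<And>x y. dist x y < \<delta> \<Longrightarrow> norm (f x - f y) \<le> \<epsilon> * dist x y"
    using littleE[OF f(1) \<epsilon>] by blast
  define \<tau> where "\<tau> = min \<epsilon> (\<epsilon> * \<delta> / 2)"
  have \<tau>: "0 < \<tau>" "\<tau> \<le> \<epsilon>" "2 * \<tau> \<le> \<epsilon> * \<delta>" using \<epsilon> \<delta>(1) by (auto simp: \<tau>_def)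
  have "n (f + v) \<le> C + \<epsilon>" if v: "v \<in> V" "n v \<le> C" "sup_norm v \<le> ennreal \<tau>" for v
  proof (rule n_leI)
    have sup: "norm (v x) \<le> \<tau>" for x using v(3) \<tau>(1) by (simp add: sup_norm_le_iff)
    have fC: "lip_le A C f" and vC: "lip_le A C v"
      using f v fV C by (auto simp flip: n_le_iff)
    have "norm (f x + v x) \<le> C + \<epsilon>" if "x \<in> A" for x
      using fC that order_trans[OF sup \<tau>(2)] by (intro norm_triangle_mono) (auto simp: lip_le_def)
    moreover have "norm ((f x - f y) + (v x - v y)) \<le> (C + \<epsilon>) * dist x y" for x y
    proof (cases "dist x y < \<delta>")
      case True
      have "norm ((f x - f y) + (v x - v y)) \<le> \<epsilon> * dist x y + C * dist x y"
        using \<delta>(2)[OF True] vC by (intro norm_triangle_mono) (auto simp: lip_le_def)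
      then show ?thesis by (simp add: algebra_simps)
    next
      case False
      have "norm (v x - v y) \<le> \<tau> + \<tau>" using norm_triangle_ineq4 sup add_mono order_trans by metis
      also have "\<dots> \<le> \<epsilon> * dist x y"
        using \<tau>(3) mult_left_mono[of \<delta> "dist x y" \<epsilon>] False \<epsilon> by linarith
      finally have "norm ((f x - f y) + (v x - v y)) \<le> C * dist x y + \<epsilon> * dist x y"
        using fC by (intro norm_triangle_mono) (auto simp: lip_le_def)
      then show ?thesis by (simp add: algebra_simps)
    qed
    ultimately show "lip_le A (C + \<epsilon>) (f + v)" by (simp add: lip_le_def algebra_simps)
  qed (use fV v C \<epsilon> in auto)
  then show ?thesis using \<tau>(1) by blast
qed

text \<open>
  The hypothesis controls difference quotients only up to a distance, here \<open>1\<close>. Beyond it they are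
  at most \<open>2 e \<le> 1 + e\<close> because \<open>h - g\<close> is uniformly at most \<open>e\<close>, where \<open>e \<le> 1\<close>.
\<close>

lemma ball_approximableD:
  assumes app: "ball_approximable W n little" and W: "W \<subseteq> V"
    and h: "h \<in> W" "n h \<le> 1" and \<epsilon>: "0 < \<epsilon>"
  shows "\<exists>g\<in>little. sup_norm (h - g) \<le> ennreal \<epsilon> \<and> n (h - g) \<le> 1 + \<epsilon>"
proof -
  define e where "e = min \<epsilon> 1"
  have e: "0 < e" "e \<le> 1" "e \<le> \<epsilon>" using \<epsilon> by (auto simp: e_def)
  obtain g where g: "g \<in> little" "sup_norm (h - g) \<le> ennreal (e * 1)"
      "\<And>x y. 0 < dist x y \<Longrightarrow> dist x y \<le> 1 \<Longrightarrow> Lquot x y (h - g) \<le> 1 + e"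
    using app[unfolded ball_approximable_def, rule_format, OF h e(1) zero_less_one] by blast
  have sup: "norm ((h - g) x) \<le> e" for x using g(2) e(1) sup_norm_le_iff[of e "h - g"] by simp
  have hg: "h - g \<in> V" using g(1) h(1) W by (auto simp: little_def)
  have "lip_le A (1 + e) (h - g)"
    unfolding lip_le_def
  proof (intro conjI ballI allI)
    show "norm ((h - g) x) \<le> 1 + e" for x using sup[of x] by linarith
    show "norm ((h - g) x - (h - g) y) \<le> (1 + e) * dist x y" for x y
    proof (cases "x = y")
      case False
      show ?thesis
      proof (cases "dist x y \<le> 1")
        case True
        then show ?thesis using g(3)[of x y] False by (simp add: Lquot_le_iff)
      next
        case large: False
        have "norm ((h - g) x - (h - g) y) \<le> e + e"
          using norm_triangle_ineq4 sup add_mono order_trans by metis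
        also have "\<dots> \<le> (1 + e) * 1" using e by simp
        also have "\<dots> \<le> (1 + e) * dist x y" using large e by (intro mult_left_mono) auto
        finally show ?thesis .
      qed
    qed simp
  qed
  then have "n (h - g) \<le> 1 + e" using e by (intro n_leI[OF hg]) auto
  then show ?thesis using g(1,2) e by (auto intro!: bexI[of _ g] elim: order_trans intro: ennreal_leI)
qed

theorem M_ideal_little:
  assumes W: "closed_subspace fun_scale V n W" and sub: "little \<subseteq> W"
    and app: "ball_approximable W n little"
  shows "M_ideal fun_scale W n little"
proof -
  interpret M: Metric_space V "norm_dist n" by (rule Metric_space_V)
  have WV: "W \<subseteq> V" and Wsub: "fun_scale.subspace W" and Wcl: "closedin M.mtopology W"
    using W by (auto simp: closed_subspace_def)
  interpret S: Submetric V "norm_dist n" W by unfold_locales (rule WV)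
  have banach: "banach_on fun_scale W n"
    unfolding banach_on_def
  proof (intro conjI ballI allI)
    show "S.sub.mcomplete" by (rule S.closedin_mcomplete_imp_mcomplete[OF Wcl mcomplete_V])
  qed (use WV Wsub in \<open>auto simp: vector_space_fun_scale n_ge0 n_eq_0_iff n_add n_scale subset_iff
      intro: S.sub.Metric_space_axioms\<close>)
  have "closedin S.sub.mtopology little"
    unfolding S.sub.closedin_metric
  proof (intro conjI allI impI sub)
    fix f assume f: "f \<in> W - little"
    then obtain r where r: "0 < r" "\<And>g. g \<in> little \<Longrightarrow> r \<le> n (f - g)"
      using little_limit_point[of f] WV by (meson DiffE not_le subsetD)
    then show "\<exists>r>0. disjnt little (S.sub.mball f r)"
      by (intro exI[of _ r]) (force simp: disjnt_iff norm_dist_def)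
  qed
  then have closed: "closed_subspace fun_scale W n little"
    using sub by (simp add: closed_subspace_def subspace_little)
  interpret glide_approximation fun_scale W little n sup_norm
  proof unfold_locales
    show "\<exists>\<tau>>0. \<forall>v\<in>W. n v \<le> C \<longrightarrow> sup_norm v \<le> ennreal \<tau> \<longrightarrow> n (f + v) \<le> C + \<epsilon>"
      if "f \<in> little" "n f \<le> C" "0 < \<epsilon>" for f C \<epsilon>
      using little_glide[OF that] WV by blast
    show "\<exists>g\<in>little. sup_norm (h - g) \<le> ennreal \<epsilon> \<and> n (h - g) \<le> 1 + \<epsilon>"
      if "h \<in> W" "n h \<le> 1" "0 < \<epsilon>" for h \<epsilon>
      by (rule ball_approximableD[OF app WV that])
  qed (use WV Wsub sub in \<open>auto simp: subspace_little n_ge0 n_eq_0_iff n_add n_scale subset_iff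
      sup_norm_add sup_norm_scale\<close>)
  show ?thesis
    unfolding M_ideal_def using banach closed annihilator_L_summand by blast
qed

end

section \<open>The two Lipschitz spaces\<close>

lemma sup_norm_uminus: "sup_norm (- f) = sup_norm f"
  by (simp add: sup_norm_def)

lemma Lconst_uminus: "Lconst (- f) = Lconst f"
  by (simp add: Lconst_def Lquot_def norm_minus_commute)

lemma ennreal_finite_iff: "x < \<infinity> \<longleftrightarrow> (\<exists>C\<ge>0. x \<le> ennreal C)"
proof
  assume "x < \<infinity>"
  then show "\<exists>C\<ge>0. x \<le> ennreal C" by (cases x) auto
qed (auto intro: le_less_trans)

lemma enn2real_le_iff: "x < \<infinity> \<Longrightarrow> 0 \<le> C \<Longrightarrow> enn2real x \<le> C \<longleftrightarrow> x \<le> ennreal C"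
  by (cases x) auto

lemma lipschitz_space_Lip:
  "lipschitz_space (Lip_space :: ('a::metric_space \<Rightarrow> 'k::{real_normed_field,banach}) set) Lip_norm UNIV {}"
proof
  fix f :: "'a \<Rightarrow> 'k" and C :: real
  have max_le: "max (sup_norm f) (Lconst f) \<le> ennreal C \<longleftrightarrow> lip_le UNIV C f" if "0 \<le> C" for C
    using that by (auto simp: lip_le_def sup_norm_le_iff Lconst_le_iff)
  have "bounded (range f) \<longleftrightarrow> (\<exists>C\<ge>0. \<forall>x. norm (f x) \<le> C)"
    unfolding bounded_iff by (auto, metis norm_ge_zero order_trans)
  also have "\<dots> \<longleftrightarrow> sup_norm f < \<infinity>"
    unfolding ennreal_finite_iff using sup_norm_le_iff[of _ f] by blast
  finally have mem: "f \<in> Lip_space \<longleftrightarrow> max (sup_norm f) (Lconst f) < \<infinity>"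
    by (simp add: Lip_space_def)
  also have "\<dots> \<longleftrightarrow> (\<exists>C\<ge>0. lip_le UNIV C f)"
    unfolding ennreal_finite_iff using max_le by blast
  finally show "f \<in> Lip_space \<longleftrightarrow> (\<exists>C\<ge>0. lip_le UNIV C f) \<and> (\<forall>z\<in>{}. f z = 0)" by simp
  show "Lip_norm f \<le> C \<longleftrightarrow> lip_le UNIV C f" if "f \<in> Lip_space" "0 \<le> C"
    using that mem max_le by (simp add: Lip_norm_def enn2real_le_iff)
qed (auto simp: Lip_norm_def sup_norm_uminus Lconst_uminus)

lemma lipschitz_space_Lip0:
  "lipschitz_space (Lip0_space x0 :: ('a::metric_space \<Rightarrow> 'k::{real_normed_field,banach}) set)
     Lip0_norm {x0} {x0}"
proof
  fix f :: "'a \<Rightarrow> 'k" and C :: real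
  have le: "Lconst f \<le> ennreal C \<longleftrightarrow> lip_le {x0} C f" if "f x0 = 0" "0 \<le> C" for C
    using that by (auto simp: lip_le_def Lconst_le_iff)
  show "f \<in> Lip0_space x0 \<longleftrightarrow> (\<exists>C\<ge>0. lip_le {x0} C f) \<and> (\<forall>z\<in>{x0}. f z = 0)"
    unfolding Lip0_space_def ennreal_finite_iff using le by auto
  show "Lip0_norm f \<le> C \<longleftrightarrow> lip_le {x0} C f" if "f \<in> Lip0_space x0" "0 \<le> C"
    using that le by (simp add: Lip0_space_def Lip0_norm_def enn2real_le_iff)
qed (auto simp: Lip0_norm_def Lconst_uminus)

theorem little_lip_M_ideal:
  fixes W :: "('a::metric_space \<Rightarrow> 'k::{real_normed_field,banach}) set"
  assumes "closed_subspace fun_scale Lip_space Lip_norm W" "little_lip \<subseteq> W"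
    "ball_approximable W Lip_norm little_lip"
  shows "M_ideal fun_scale W Lip_norm little_lip"
proof -
  interpret lipschitz_space "Lip_space :: ('a \<Rightarrow> 'k) set" Lip_norm UNIV "{}"
    by (rule lipschitz_space_Lip)
  show ?thesis using M_ideal_little assms by (simp add: little_def little_lip_def)
qed

theorem little_lip0_M_ideal:
  fixes W :: "('a::metric_space \<Rightarrow> 'k::{real_normed_field,banach}) set"
  assumes "closed_subspace fun_scale (Lip0_space x0) Lip0_norm W" "little_lip0 x0 \<subseteq> W"
    "ball_approximable W Lip0_norm (little_lip0 x0)"
  shows "M_ideal fun_scale W Lip0_norm (little_lip0 x0)"
proof -
  interpret lipschitz_space "Lip0_space x0 :: ('a \<Rightarrow> 'k) set" Lip0_norm "{x0}" "{x0}"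
    by (rule lipschitz_space_Lip0)
  show ?thesis using M_ideal_little assms by (simp add: little_def little_lip0_def)
qed

theorem lemma2p4:
  fixes x0 :: "'a::metric_space"
  shows
    "(\<forall>W :: ('a \<Rightarrow> real) set.
        closed_subspace fun_scale Lip_space Lip_norm W \<longrightarrow> little_lip \<subseteq> W \<longrightarrow>
        ball_approximable W Lip_norm little_lip \<longrightarrow>
        M_ideal fun_scale W Lip_norm little_lip) \<and>
     (\<forall>W :: ('a \<Rightarrow> complex) set.
        closed_subspace fun_scale Lip_space Lip_norm W \<longrightarrow> little_lip \<subseteq> W \<longrightarrow>
        ball_approximable W Lip_norm little_lip \<longrightarrow>
        M_ideal fun_scale W Lip_norm little_lip) \<and>
     (\<forall>W :: ('a \<Rightarrow> real) set.
        closed_subspace fun_scale (Lip0_space x0) Lip0_norm W \<longrightarrow> little_lip0 x0 \<subseteq> W \<longrightarrow>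
        ball_approximable W Lip0_norm (little_lip0 x0) \<longrightarrow>
        M_ideal fun_scale W Lip0_norm (little_lip0 x0)) \<and>
     (\<forall>W :: ('a \<Rightarrow> complex) set.
        closed_subspace fun_scale (Lip0_space x0) Lip0_norm W \<longrightarrow> little_lip0 x0 \<subseteq> W \<longrightarrow>
        ball_approximable W Lip0_norm (little_lip0 x0) \<longrightarrow>
        M_ideal fun_scale W Lip0_norm (little_lip0 x0))"
  by (intro conjI allI impI little_lip_M_ideal little_lip0_M_ideal)

end
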